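(* Let $(\mathfrak A,\varphi)$ be a C$^*$-non-commutative probability space and let $\mathbf X=(X_1,\dots,X_n)$, $\mathbf Y=(Y_1,\dots,Y_m)$ be tuples of self-adjoint operators in $\mathfrak A$ such that $(\mathbb C\langle\mathbf X\rangle,\mathbb C\langle\mathbf Y\rangle)$ is tracially bi-partite, and suppose $\mathbf X,\mathbf Y$ satisfy no algebraic relations other than $[X_i,Y_j]=0$ for all $i,j$; let $\mathcal A=\mathbb C\langle\mathbf X,\mathbf Y\rangle$. Assume there is a C$^*$-non-commutative probability space $(\mathcal A_0,\tau_0)$ with $\tau_0$ tracial and tuples of self-adjoint operators $\mathbf X'=(X_1',\dots,X_n')$, $\mathbf Y'=(Y_1',\dots,Y_m')$ in $\mathcal A_0$ such that \[\varphi(X_{i_1}\cdots X_{i_p}Y_{j_1}\cdots Y_{j_q})=\tau_0(X'_{i_1}\cdots X'_{i_p}Y'_{j_q}\cdots Y'_{j_1})\] for all $p,q\ge0$ and all indices. Then there is an isometry $\Psi:L_2(\mathcal A,\varphi)\to L_2(\mathcal A_0,\tau_0)$ with $\Psi(X_{i_1}\cdots X_{i_p}Y_{j_1}\cdots Y_{j_q})=X'_{i_1}\cdots X'_{i_p}Y'_{j_q}\cdots Y'_{j_1}$ for all $p,q\ge0$ and all indices. Moreover, if $P$ is the orthogonal projection of $L_2(\mathcal A_0,\tau_0)$ onto $\Psi(L_2(\mathcal A,\varphi))$ and the free conjugate variable $\mathcal J(X_i':\mathbb C\langle\hat{\mathbf X}_i',\mathbf Y'\rangle)$ exists, then $\mathcal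 J_\ell(X_i:(\mathbb C\langle\hat{\mathbf X}_i\rangle,\mathbb C\langle\mathbf Y\rangle))$ exists and \[\mathcal J_\ell(X_i:(\mathbb C\langle\hat{\mathbf X}_i\rangle,\mathbb C\langle\mathbf Y\rangle))=\Psi^{-1}\big(P(\mathcal J(X_i':\mathbb C\langle\hat{\mathbf X}_i',\mathbf Y'\rangle))\big).\] A similar result holds for the right bi-free conjugate variables.
   Context: A C$^*$-non-commutative probability space is a unital C$^*$-algebra with a state; $L_2(\mathcal B,\varphi)$ is the closure of a subalgebra $\mathcal B$ in the GNS space with $\langle Z_1,Z_2\rangle=\varphi(Z_2^*Z_1)$, and $\varphi(Z\zeta):=\langle Z\zeta,1\rangle$. $\hat{\mathbf X}_i$ denotes $\mathbf X$ with $X_i$ removed. $(\mathbb C\langle\mathbf X\rangle,\mathbb C\langle\mathbf Y\rangle)$ is tracially bi-partite if every element of $\mathbb C\langle\mathbf X\rangle$ commutes with every element of $\mathbb C\langle\mathbf Y\rangle$ and $\varphi$ is tracial on each of these two algebras. Left bi-free difference quotient: with left letters $L$ and right letters $R$ and $X\in L$, for a word $Z_1\cdots Z_k$ in $L\cup R$, $\partial_{\ell,X}(Z_1\cdots Z_k)=\sum_{q:Z_q=X}\big(Z_1\cdots Z_{q-1}\prod_{p>q,Z_p\in R}Z_p\big)\otimes\prod_{p>q,Z_p\in L}Z_p$ (products in increasing index order). The left bi-free conjugate variable $\mathcal J_\ell(X_i:(\mathbb C\langle\hat{\mathbf X}_i\rangle,\mathbb C\langle\mathbf Y\rangle))$ is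 the unique (if it exists) $\xi\in L_2(\mathcal A,\varphi)$ with $\varphi(W\xi)=(\varphi\otimes\varphi)(\partial_{\ell,X_i}(W))$ for every word $W$ in the left letters $X_1,\dots,X_n$ and right letters $Y_1,\dots,Y_m$ (the paper defines it equivalently via bi-free cumulants). The free conjugate variable $\mathcal J(X_i':\mathbb C\langle\hat{\mathbf X}_i',\mathbf Y'\rangle)$ (Voiculescu) is the $\xi'\in L_2(\mathbb C\langle\mathbf X',\mathbf Y'\rangle,\tau_0)$ with $\tau_0(p(\mathbf X',\mathbf Y')\xi')=(\tau_0\otimes\tau_0)((\partial_ip)(\mathbf X',\mathbf Y'))$ for all non-commutative polynomials $p$, where $\partial_i$ is the free difference quotient (the derivation with $\partial_i(X_i)=1\otimes1$, killing the other variables, with bimodule structure $a(P\otimes Q)b=aP\otimes Qb$). *)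

theory Defs
  imports Complex_Main
begin

section \<open>Unital C*-algebras (carrier = whole type) and states\<close>

record 'a cstar_alg =
  cadd :: "'a \<Rightarrow> 'a \<Rightarrow> 'a"
  cmul :: "'a \<Rightarrow> 'a \<Rightarrow> 'a"
  csc  :: "complex \<Rightarrow> 'a \<Rightarrow> 'a"
  cstar :: "'a \<Rightarrow> 'a"
  cnorm :: "'a \<Rightarrow> real"
  czero :: 'a
  cone :: 'a

definition csub :: "'a cstar_alg \<Rightarrow> 'a \<Rightarrow> 'a \<Rightarrow> 'a" where
  "csub A a b = cadd A a (csc A (-1) b)"

definition cstar_algebra :: "'a cstar_alg \<Rightarrow> bool" where
  "cstar_algebra A \<longleftrightarrow>
    (\<forall>a b c. cadd A (cadd A a b) c = cadd A a (cadd A b c)) \<and>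
    (\<forall>a b. cadd A a b = cadd A b a) \<and>
    (\<forall>a. cadd A a (czero A) = a) \<and>
    (\<forall>a. cadd A a (csc A (-1) a) = czero A) \<and>
    (\<forall>a. csc A 1 a = a) \<and>
    (\<forall>s t a. csc A s (csc A t a) = csc A (s * t) a) \<and>
    (\<forall>s t a. csc A (s + t) a = cadd A (csc A s a) (csc A t a)) \<and>
    (\<forall>s a b. csc A s (cadd A a b) = cadd A (csc A s a) (csc A s b)) \<and>
    (\<forall>a b c. cmul A (cmul A a b) c = cmul A a (cmul A b c)) \<and>
    (\<forall>a b c. cmul A a (cadd A b c) = cadd A (cmul A a b) (cmul A a c)) \<and>
    (\<forall>a b c. cmul A (cadd A a b) c = cadd A (cmul A a c) (cmul A b c)) \<and>
    (\<forall>s a b. cmul A (csc A s a) b = csc A s (cmul A a b)) \<and>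
    (\<forall>s a b. cmul A a (csc A s b) = csc A s (cmul A a b)) \<and>
    (\<forall>a. cmul A (cone A) a = a \<and> cmul A a (cone A) = a) \<and>
    (\<forall>a. cstar A (cstar A a) = a) \<and>
    (\<forall>a b. cstar A (cadd A a b) = cadd A (cstar A a) (cstar A b)) \<and>
    (\<forall>s a. cstar A (csc A s a) = csc A (cnj s) (cstar A a)) \<and>
    (\<forall>a b. cstar A (cmul A a b) = cmul A (cstar A b) (cstar A a)) \<and>
    (\<forall>a. 0 \<le> cnorm A a) \<and>
    (\<forall>a. cnorm A a = 0 \<longleftrightarrow> a = czero A) \<and>
    (\<forall>a b. cnorm A (cadd A a b) \<le> cnorm A a + cnorm A b) \<and>
    (\<forall>s a. cnorm A (csc A s a) = cmod s * cnorm A a) \<and>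
    (\<forall>a b. cnorm A (cmul A a b) \<le> cnorm A a * cnorm A b) \<and>
    (\<forall>a. cnorm A (cmul A (cstar A a) a) = (cnorm A a)^2) \<and>
    (\<forall>f :: nat \<Rightarrow> 'a. (\<forall>e>0. \<exists>N. \<forall>k\<ge>N. \<forall>l\<ge>N. cnorm A (csub A (f k) (f l)) < e) \<longrightarrow>
        (\<exists>x. \<forall>e>0. \<exists>N. \<forall>k\<ge>N. cnorm A (csub A (f k) x) < e))"

definition is_state :: "'a cstar_alg \<Rightarrow> ('a \<Rightarrow> complex) \<Rightarrow> bool" where
  "is_state A \<phi> \<longleftrightarrow>
    (\<forall>a b. \<phi> (cadd A a b) = \<phi> a + \<phi> b) \<and>
    (\<forall>s a. \<phi> (csc A s a) = s * \<phi> a) \<and>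
    \<phi> (cone A) = 1 \<and>
    (\<forall>a. Im (\<phi> (cmul A (cstar A a) a)) = 0 \<and> 0 \<le> Re (\<phi> (cmul A (cstar A a) a)))"

definition cstar_ncps :: "'a cstar_alg \<Rightarrow> ('a \<Rightarrow> complex) \<Rightarrow> bool" where
  "cstar_ncps A \<phi> \<longleftrightarrow> cstar_algebra A \<and> is_state A \<phi>"

definition tracial_on :: "'a cstar_alg \<Rightarrow> ('a \<Rightarrow> complex) \<Rightarrow> 'a set \<Rightarrow> bool" where
  "tracial_on A \<phi> B \<longleftrightarrow> (\<forall>a\<in>B. \<forall>b\<in>B. \<phi> (cmul A a b) = \<phi> (cmul A b a))"

text \<open>Unital subalgebra generated by a set S (= C<S>).\<close>
inductive_set alg_gen :: "'a cstar_alg \<Rightarrow> 'a set \<Rightarrow> 'a set" for A S where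
  one: "cone A \<in> alg_gen A S"
| gen: "s \<in> S \<Longrightarrow> s \<in> alg_gen A S"
| add: "a \<in> alg_gen A S \<Longrightarrow> b \<in> alg_gen A S \<Longrightarrow> cadd A a b \<in> alg_gen A S"
| mul: "a \<in> alg_gen A S \<Longrightarrow> b \<in> alg_gen A S \<Longrightarrow> cmul A a b \<in> alg_gen A S"
| sc: "a \<in> alg_gen A S \<Longrightarrow> csc A c a \<in> alg_gen A S"

record 'h hspace =
  hadd :: "'h \<Rightarrow> 'h \<Rightarrow> 'h"
  hsc :: "complex \<Rightarrow> 'h \<Rightarrow> 'h"
  hzero :: 'h
  hinner :: "'h \<Rightarrow> 'h \<Rightarrow> complex"

definition hsub :: "'h hspace \<Rightarrow> 'h \<Rightarrow> 'h \<Rightarrow> 'h" where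
  "hsub H x y = hadd H x (hsc H (-1) y)"

definition hnorm :: "'h hspace \<Rightarrow> 'h \<Rightarrow> real" where
  "hnorm H x = sqrt (Re (hinner H x x))"

definition hilbert :: "'h hspace \<Rightarrow> bool" where
  "hilbert H \<longleftrightarrow>
    (\<forall>x y z. hadd H (hadd H x y) z = hadd H x (hadd H y z)) \<and>
    (\<forall>x y. hadd H x y = hadd H y x) \<and>
    (\<forall>x. hadd H x (hzero H) = x) \<and>
    (\<forall>x. hadd H x (hsc H (-1) x) = hzero H) \<and>
    (\<forall>x. hsc H 1 x = x) \<and>
    (\<forall>s t x. hsc H s (hsc H t x) = hsc H (s * t) x) \<and>
    (\<forall>s t x. hsc H (s + t) x = hadd H (hsc H s x) (hsc H t x)) \<and>
    (\<forall>s x y. hsc H s (hadd H x y) = hadd H (hsc H s x) (hsc H s y)) \<and>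
    (\<forall>x y z. hinner H (hadd H x y) z = hinner H x z + hinner H y z) \<and>
    (\<forall>s x y. hinner H (hsc H s x) y = s * hinner H x y) \<and>
    (\<forall>x y. hinner H x y = cnj (hinner H y x)) \<and>
    (\<forall>x. Im (hinner H x x) = 0 \<and> 0 \<le> Re (hinner H x x)) \<and>
    (\<forall>x. hinner H x x = 0 \<longrightarrow> x = hzero H) \<and>
    (\<forall>f :: nat \<Rightarrow> 'h. (\<forall>e>0. \<exists>N. \<forall>k\<ge>N. \<forall>l\<ge>N. hnorm H (hsub H (f k) (f l)) < e) \<longrightarrow>
        (\<exists>x. \<forall>e>0. \<exists>N. \<forall>k\<ge>N. hnorm H (hsub H (f k) x) < e))"

definition hclosure :: "'h hspace \<Rightarrow> 'h set \<Rightarrow> 'h set" where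
  "hclosure H S = {x. \<forall>e>0. \<exists>s\<in>S. hnorm H (hsub H x s) < e}"

definition orth_proj :: "'h hspace \<Rightarrow> 'h set \<Rightarrow> ('h \<Rightarrow> 'h) \<Rightarrow> bool" where
  "orth_proj H M P \<longleftrightarrow> (\<forall>x. P x \<in> M \<and> (\<forall>y\<in>M. hinner H (hsub H x (P x)) y = 0))"

definition isometry_on :: "'h hspace \<Rightarrow> 'h set \<Rightarrow> 'k hspace \<Rightarrow> ('h \<Rightarrow> 'k) \<Rightarrow> bool" where
  "isometry_on H M H' \<Psi> \<longleftrightarrow>
    (\<forall>x\<in>M. \<forall>y\<in>M. \<Psi> (hadd H x y) = hadd H' (\<Psi> x) (\<Psi> y)) \<and>
    (\<forall>s. \<forall>x\<in>M. \<Psi> (hsc H s x) = hsc H' s (\<Psi> x)) \<and>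
    (\<forall>x\<in>M. hnorm H' (\<Psi> x) = hnorm H x)"

text \<open>(H, iota, pi) is a GNS realization of (A, phi): iota A is dense in H,
  <iota a, iota b> = phi(b* a), and pi a is the (bounded, linear) left action of a.\<close>
definition gns :: "'a cstar_alg \<Rightarrow> ('a \<Rightarrow> complex) \<Rightarrow> 'h hspace \<Rightarrow> ('a \<Rightarrow> 'h)
    \<Rightarrow> ('a \<Rightarrow> 'h \<Rightarrow> 'h) \<Rightarrow> bool" where
  "gns A \<phi> H \<iota> \<pi> \<longleftrightarrow> hilbert H \<and>
    (\<forall>a b. \<iota> (cadd A a b) = hadd H (\<iota> a) (\<iota> b)) \<and>
    (\<forall>s a. \<iota> (csc A s a) = hsc H s (\<iota> a)) \<and>
    (\<forall>a b. hinner H (\<iota> a) (\<iota> b) = \<phi> (cmul A (cstar A b) a)) \<and>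
    hclosure H (range \<iota>) = UNIV \<and>
    (\<forall>a b. \<pi> a (\<iota> b) = \<iota> (cmul A a b)) \<and>
    (\<forall>a x y. \<pi> a (hadd H x y) = hadd H (\<pi> a x) (\<pi> a y)) \<and>
    (\<forall>a s x. \<pi> a (hsc H s x) = hsc H s (\<pi> a x)) \<and>
    (\<forall>a. \<exists>C. \<forall>x. hnorm H (\<pi> a x) \<le> C * hnorm H x)"

definition L2 :: "'h hspace \<Rightarrow> ('a \<Rightarrow> 'h) \<Rightarrow> 'a set \<Rightarrow> 'h set" where
  "L2 H \<iota> B = hclosure H (\<iota> ` B)"

datatype lett = LX nat | LY nat

fun isLX :: "lett \<Rightarrow> bool" where
  "isLX (LX _) = True" | "isLX (LY _) = False"

fun isLY :: "lett \<Rightarrow> bool" where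
  "isLY (LX _) = False" | "isLY (LY _) = True"

fun valid_lett :: "nat \<Rightarrow> nat \<Rightarrow> lett \<Rightarrow> bool" where
  "valid_lett n m (LX i) = (i < n)" | "valid_lett n m (LY j) = (j < m)"

definition valid_word :: "nat \<Rightarrow> nat \<Rightarrow> lett list \<Rightarrow> bool" where
  "valid_word n m w \<longleftrightarrow> (\<forall>l\<in>set w. valid_lett n m l)"

fun lett_val :: "(nat \<Rightarrow> 'a) \<Rightarrow> (nat \<Rightarrow> 'a) \<Rightarrow> lett \<Rightarrow> 'a" where
  "lett_val X Y (LX i) = X i" | "lett_val X Y (LY j) = Y j"

fun evalw :: "'a cstar_alg \<Rightarrow> (nat \<Rightarrow> 'a) \<Rightarrow> (nat \<Rightarrow> 'a) \<Rightarrow> lett list \<Rightarrow> 'a" where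
  "evalw A X Y [] = cone A"
| "evalw A X Y (l # w) = cmul A (lett_val X Y l) (evalw A X Y w)"

definition eval_lin :: "'a cstar_alg \<Rightarrow> (nat \<Rightarrow> 'a) \<Rightarrow> (nat \<Rightarrow> 'a) \<Rightarrow> (complex \<times> lett list) list \<Rightarrow> 'a" where
  "eval_lin A X Y cs = foldr (\<lambda>(c, w) acc. cadd A (csc A c (evalw A X Y w)) acc) cs (czero A)"

text \<open>X, Y satisfy no algebraic relations other than [X_i, Y_j] = 0: a linear combination of
  words in the X_i, Y_j vanishes only if it lies in the ideal generated by the commutators
  in the free algebra, i.e. only if, for every class of words equal modulo commuting X-letters
  past Y-letters (class determined by (X-subword, Y-subword)), the coefficients sum to 0.\<close>
definition no_other_relations :: "'a cstar_alg \<Rightarrow> nat \<Rightarrow> nat \<Rightarrow> (nat \<Rightarrow> 'a) \<Rightarrow> (nat \<Rightarrow> 'a) \<Rightarrow> bool" where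
  "no_other_relations A n m X Y \<longleftrightarrow>
    (\<forall>cs. (\<forall>(c, w)\<in>set cs. valid_word n m w) \<longrightarrow> eval_lin A X Y cs = czero A \<longrightarrow>
      (\<forall>u v. sum_list (map fst (filter (\<lambda>(c, w). filter isLX w = u \<and> filter isLY w = v) cs)) = 0))"

definition tracially_bipartite :: "'a cstar_alg \<Rightarrow> ('a \<Rightarrow> complex) \<Rightarrow> nat \<Rightarrow> nat
    \<Rightarrow> (nat \<Rightarrow> 'a) \<Rightarrow> (nat \<Rightarrow> 'a) \<Rightarrow> bool" where
  "tracially_bipartite A \<phi> n m X Y \<longleftrightarrow>
    (\<forall>a\<in>alg_gen A (X ` {..<n}). \<forall>b\<in>alg_gen A (Y ` {..<m}). cmul A a b = cmul A b a) \<and>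
    tracial_on A \<phi> (alg_gen A (X ` {..<n})) \<and> tracial_on A \<phi> (alg_gen A (Y ` {..<m}))"

text \<open>(phi (x) phi)(partial_{l, X_i}(w)) for a word w.\<close>
definition bfdq_val :: "'a cstar_alg \<Rightarrow> ('a \<Rightarrow> complex) \<Rightarrow> (nat \<Rightarrow> 'a) \<Rightarrow> (nat \<Rightarrow> 'a)
    \<Rightarrow> nat \<Rightarrow> lett list \<Rightarrow> complex" where
  "bfdq_val A \<phi> X Y i w =
    (\<Sum>q\<in>{q. q < length w \<and> w ! q = LX i}.
       \<phi> (evalw A X Y (take q w @ filter isLY (drop (Suc q) w))) *
       \<phi> (evalw A X Y (filter isLX (drop (Suc q) w))))"

definition is_left_bf_conj :: "'a cstar_alg \<Rightarrow> ('a \<Rightarrow> complex) \<Rightarrow> 'h hspace \<Rightarrow> ('a \<Rightarrow> 'h)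
    \<Rightarrow> ('a \<Rightarrow> 'h \<Rightarrow> 'h) \<Rightarrow> nat \<Rightarrow> nat \<Rightarrow> (nat \<Rightarrow> 'a) \<Rightarrow> (nat \<Rightarrow> 'a) \<Rightarrow> nat \<Rightarrow> 'h \<Rightarrow> bool" where
  "is_left_bf_conj A \<phi> H \<iota> \<pi> n m X Y i \<xi> \<longleftrightarrow>
    \<xi> \<in> L2 H \<iota> (alg_gen A (X ` {..<n} \<union> Y ` {..<m})) \<and>
    (\<forall>w. valid_word n m w \<longrightarrow>
       hinner H (\<pi> (evalw A X Y w) \<xi>) (\<iota> (cone A)) = bfdq_val A \<phi> X Y i w)"

text \<open>(tau (x) tau)((partial_i w)(X', Y')) for a monomial w.\<close>
definition fdq_val :: "'a cstar_alg \<Rightarrow> ('a \<Rightarrow> complex) \<Rightarrow> (nat \<Rightarrow> 'a) \<Rightarrow> (nat \<Rightarrow> 'a)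
    \<Rightarrow> nat \<Rightarrow> lett list \<Rightarrow> complex" where
  "fdq_val A \<tau> X Y i w =
    (\<Sum>q\<in>{q. q < length w \<and> w ! q = LX i}.
       \<tau> (evalw A X Y (take q w)) * \<tau> (evalw A X Y (drop (Suc q) w)))"

text \<open>xi is Voiculescu's free conjugate variable J(X'_i : C<X'^_i, Y'>) in L_2(C<X',Y'>, tau)
  (tested on monomials; by linearity equivalent to testing on all polynomials).\<close>
definition is_free_conj :: "'a cstar_alg \<Rightarrow> ('a \<Rightarrow> complex) \<Rightarrow> 'h hspace \<Rightarrow> ('a \<Rightarrow> 'h)
    \<Rightarrow> ('a \<Rightarrow> 'h \<Rightarrow> 'h) \<Rightarrow> nat \<Rightarrow> nat \<Rightarrow> (nat \<Rightarrow> 'a) \<Rightarrow> (nat \<Rightarrow> 'a) \<Rightarrow> nat \<Rightarrow> 'h \<Rightarrow> bool" where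
  "is_free_conj A \<tau> H \<iota> \<pi> n m X Y i \<xi> \<longleftrightarrow>
    \<xi> \<in> L2 H \<iota> (alg_gen A (X ` {..<n} \<union> Y ` {..<m})) \<and>
    (\<forall>w. valid_word n m w \<longrightarrow>
       hinner H (\<pi> (evalw A X Y w) \<xi>) (\<iota> (cone A)) = fdq_val A \<tau> X Y i w)"

end

(*
  Sending a word X_{i_1}...X_{i_p} Y_{j_1}...Y_{j_q} to X'_{i_1}...X'_{i_p} Y'_{j_q}...Y'_{j_1}
  preserves inner products: phi(W_2* W_1) is evaluated by moving the X-letters of W_2* W_1 in
  front of the Y-letters, applying the moment identity, and rotating the resulting tau_0-moment
  by traciality into tau_0(W_2'* W_1'). Since linear combinations of words are dense, this
  correspondence extends by continuity to an isometry Psi, whatever the relations among the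
  words are.

  If xi' is the free conjugate variable, then for every word W the vector Psi^{-1}(P xi')
  has the same inner product with W as xi' has with Psi(W), namely the free difference quotient
  of the image word. Occurrences of X_i in the image word are exactly those in the X-part of W,
  and cutting there gives a left factor containing all Y-letters of W together with the earlier
  X-letters, and a right factor of the later X-letters: precisely the splitting of the left
  bi-free difference quotient. Uniqueness again follows from density of the words.
*)

theory Submission
  imports Defs
begin

lemma calg_axioms:
  assumes "cstar_algebra A"
  shows calg_add_assoc: "cadd A (cadd A a b) c = cadd A a (cadd A b c)"
  and calg_add_comm: "cadd A a b = cadd A b a"
  and calg_add_zero: "cadd A a (czero A) = a"
  and calg_add_neg: "cadd A a (csc A (-1) a) = czero A"
  and calg_sc_one: "csc A 1 a = a"
  and calg_sc_sc: "csc A s (csc A t a) = csc A (s * t) a"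
  and calg_sc_add_left: "csc A (s + t) a = cadd A (csc A s a) (csc A t a)"
  and calg_sc_add_right: "csc A s (cadd A a b) = cadd A (csc A s a) (csc A s b)"
  and calg_mul_assoc: "cmul A (cmul A a b) c = cmul A a (cmul A b c)"
  and calg_distrib_left: "cmul A a (cadd A b c) = cadd A (cmul A a b) (cmul A a c)"
  and calg_distrib_right: "cmul A (cadd A a b) c = cadd A (cmul A a c) (cmul A b c)"
  and calg_sc_mul_left: "cmul A (csc A s a) b = csc A s (cmul A a b)"
  and calg_sc_mul_right: "cmul A a (csc A s b) = csc A s (cmul A a b)"
  and calg_one_mul: "cmul A (cone A) a = a"
  and calg_mul_one: "cmul A a (cone A) = a"
  and calg_star_star: "cstar A (cstar A a) = a"
  and calg_star_add: "cstar A (cadd A a b) = cadd A (cstar A a) (cstar A b)"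
  and calg_star_sc: "cstar A (csc A s a) = csc A (cnj s) (cstar A a)"
  and calg_star_mul: "cstar A (cmul A a b) = cmul A (cstar A b) (cstar A a)"
  using assms unfolding cstar_algebra_def by ((elim conjE)?, metis)+

lemma calg_add_right_eq_self:
  assumes "cstar_algebra A" "cadd A a b = a" shows "b = czero A"
proof -
  have "b = cadd A b (cadd A a (csc A (-1) a))" using calg_axioms[OF assms(1)] by simp
  also have "\<dots> = cadd A (cadd A a b) (csc A (-1) a)" using calg_axioms[OF assms(1)] by metis
  also have "\<dots> = czero A" using assms calg_axioms[OF assms(1)] by simp
  finally show ?thesis .
qed

lemma calg_zero_add: "cstar_algebra A \<Longrightarrow> cadd A (czero A) a = a"
  using calg_add_comm calg_add_zero by metis

lemma calg_sc_0: "cstar_algebra A \<Longrightarrow> csc A 0 a = czero A"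
  by (rule calg_add_right_eq_self[of A "csc A 0 a"], assumption) (metis calg_sc_add_left add_0)

lemma calg_sc_zero: "cstar_algebra A \<Longrightarrow> csc A c (czero A) = czero A"
  by (rule calg_add_right_eq_self[of A "csc A c (czero A)"], assumption) (metis calg_sc_add_right calg_add_zero)

lemma calg_mul_zero: "cstar_algebra A \<Longrightarrow> cmul A a (czero A) = czero A"
  by (rule calg_add_right_eq_self[of A "cmul A a (czero A)"], assumption) (metis calg_distrib_left calg_add_zero)

lemma calg_zero_mul: "cstar_algebra A \<Longrightarrow> cmul A (czero A) a = czero A"
  by (rule calg_add_right_eq_self[of A "cmul A (czero A) a"], assumption) (metis calg_distrib_right calg_add_zero)

lemma calg_star_zero: "cstar_algebra A \<Longrightarrow> cstar A (czero A) = czero A"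
  by (metis calg_sc_0 calg_star_sc complex_cnj_zero)

lemma calg_star_one: "cstar_algebra A \<Longrightarrow> cstar A (cone A) = cone A"
  by (metis calg_mul_one calg_star_mul calg_star_star)

lemma state_axioms:
  assumes "is_state A \<phi>"
  shows state_add: "\<phi> (cadd A a b) = \<phi> a + \<phi> b"
  and state_sc: "\<phi> (csc A s a) = s * \<phi> a"
  using assms unfolding is_state_def by blast+

lemma state_zero: "cstar_algebra A \<Longrightarrow> is_state A \<phi> \<Longrightarrow> \<phi> (czero A) = 0"
  by (metis calg_sc_0 mult_zero_left state_sc)

lemma valid_word_append [simp]: "valid_word n m (u @ v) \<longleftrightarrow> valid_word n m u \<and> valid_word n m v"
  by (auto simp: valid_word_def)

lemma valid_word_rev [simp]: "valid_word n m (rev u) \<longleftrightarrow> valid_word n m u"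
  by (auto simp: valid_word_def)

lemma valid_word_Nil [simp]: "valid_word n m []"
  by (simp add: valid_word_def)

lemma valid_word_filter: "valid_word n m u \<Longrightarrow> valid_word n m (filter P u)"
  by (auto simp: valid_word_def)

lemma valid_word_take: "valid_word n m u \<Longrightarrow> valid_word n m (take k u)"
  by (auto simp: valid_word_def dest: in_set_takeD)

lemma valid_word_drop: "valid_word n m u \<Longrightarrow> valid_word n m (drop k u)"
  by (auto simp: valid_word_def dest: in_set_dropD)

lemma evalw_append:
  "cstar_algebra A \<Longrightarrow> evalw A X Y (u @ v) = cmul A (evalw A X Y u) (evalw A X Y v)"
  by (induction u) (auto simp: calg_one_mul calg_mul_assoc)

lemma star_evalw:
  assumes "cstar_algebra A" "\<forall>i<n. cstar A (X i) = X i" "\<forall>j<m. cstar A (Y j) = Y j"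
    and "valid_word n m w"
  shows "cstar A (evalw A X Y w) = evalw A X Y (rev w)"
  using assms(4)
proof (induction w)
  case Nil
  show ?case using assms(1) by (simp add: calg_star_one)
next
  case (Cons l w)
  have "valid_word n m w" using Cons.prems by (simp add: valid_word_def)
  moreover have "cstar A (lett_val X Y l) = lett_val X Y l"
    using Cons.prems assms(2,3) by (cases l) (auto simp: valid_word_def)
  ultimately show ?case using Cons.IH assms(1)
    by (simp add: calg_star_mul evalw_append calg_mul_one)
qed

lemma evalw_in_alg_gen:
  "valid_word n m w \<Longrightarrow> evalw A X Y w \<in> alg_gen A (X ` {..<n} \<union> Y ` {..<m})"
proof (induction w)
  case (Cons l w)
  then have "lett_val X Y l \<in> alg_gen A (X ` {..<n} \<union> Y ` {..<m})"
    by (cases l) (auto simp: valid_word_def intro: alg_gen.gen)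
  with Cons show ?case by (simp add: valid_word_def alg_gen.mul)
qed (simp add: alg_gen.one)

lemma sum_list_concat: "sum_list (concat xss) = sum_list (map sum_list (xss :: 'a::monoid_add list list))"
  by (induction xss) auto

definition valid_lin :: "nat \<Rightarrow> nat \<Rightarrow> (complex \<times> lett list) list \<Rightarrow> bool" where
  "valid_lin n m cs \<longleftrightarrow> (\<forall>(c, w)\<in>set cs. valid_word n m w)"

definition scale_lin :: "complex \<Rightarrow> (complex \<times> lett list) list \<Rightarrow> (complex \<times> lett list) list" where
  "scale_lin s cs = map (\<lambda>(d, w). (s * d, w)) cs"

definition mult_lin :: "(complex \<times> lett list) list \<Rightarrow> (complex \<times> lett list) list
    \<Rightarrow> (complex \<times> lett list) list" where
  "mult_lin cs ds = concat (map (\<lambda>(c, v). map (\<lambda>(d, w). (c * d, v @ w)) ds) cs)"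

lemma valid_lin_append [simp]: "valid_lin n m (cs @ ds) \<longleftrightarrow> valid_lin n m cs \<and> valid_lin n m ds"
  by (auto simp: valid_lin_def)

lemma valid_lin_scale [simp]: "valid_lin n m (scale_lin s cs) \<longleftrightarrow> valid_lin n m cs"
  by (auto simp: valid_lin_def scale_lin_def)

lemma valid_lin_single [simp]: "valid_lin n m [(c, w)] \<longleftrightarrow> valid_word n m w"
  by (simp add: valid_lin_def)

lemma valid_lin_mult: "valid_lin n m cs \<Longrightarrow> valid_lin n m ds \<Longrightarrow> valid_lin n m (mult_lin cs ds)"
  by (fastforce simp: valid_lin_def mult_lin_def)

lemma eval_lin_Nil [simp]: "eval_lin A X Y [] = czero A"
  by (simp add: eval_lin_def)

lemma eval_lin_Cons [simp]:
  "eval_lin A X Y ((c, w) # cs) = cadd A (csc A c (evalw A X Y w)) (eval_lin A X Y cs)"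
  by (simp add: eval_lin_def)

lemma eval_lin_single: "cstar_algebra A \<Longrightarrow> eval_lin A X Y [(1, w)] = evalw A X Y w"
  by (simp add: calg_sc_one calg_add_zero)

lemma eval_lin_append: "cstar_algebra A \<Longrightarrow>
    eval_lin A X Y (cs @ ds) = cadd A (eval_lin A X Y cs) (eval_lin A X Y ds)"
  by (induction cs) (auto simp: calg_zero_add calg_add_assoc)

lemma eval_lin_scale: "cstar_algebra A \<Longrightarrow>
    eval_lin A X Y (scale_lin s cs) = csc A s (eval_lin A X Y cs)"
  by (induction cs) (auto simp: scale_lin_def calg_sc_zero calg_sc_add_right calg_sc_sc)

lemma eval_lin_mult: "cstar_algebra A \<Longrightarrow>
    cmul A (eval_lin A X Y cs) (eval_lin A X Y ds) = eval_lin A X Y (mult_lin cs ds)"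
proof (induction cs)
  case Nil
  then show ?case by (simp add: mult_lin_def calg_zero_mul)
next
  case (Cons cv cs)
  obtain c v where cv: "cv = (c, v)" by force
  have "cmul A (evalw A X Y v) (eval_lin A X Y ds) = eval_lin A X Y (map (\<lambda>(d, w). (d, v @ w)) ds)"
    using Cons.prems
    by (induction ds) (auto simp: calg_mul_zero calg_distrib_left calg_sc_mul_right evalw_append)
  moreover have "map (\<lambda>(d, w). (c * d, v @ w)) ds = scale_lin c (map (\<lambda>(d, w). (d, v @ w)) ds)"
    by (simp add: scale_lin_def split_def)
  ultimately show ?case using Cons
    by (simp add: cv mult_lin_def calg_distrib_right calg_sc_mul_left eval_lin_append eval_lin_scale)
qed

lemma star_eval_lin:
  assumes "cstar_algebra A" "\<forall>i<n. cstar A (X i) = X i" "\<forall>j<m. cstar A (Y j) = Y j"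
    and "valid_lin n m cs"
  shows "cstar A (eval_lin A X Y cs) = eval_lin A X Y (map (\<lambda>(c, w). (cnj c, rev w)) cs)"
  using assms(4)
proof (induction cs)
  case Nil
  then show ?case using assms(1) by (simp add: calg_star_zero)
next
  case (Cons cv cs)
  then show ?case using star_evalw[OF assms(1-3)] assms(1)
    by (cases cv) (auto simp: valid_lin_def calg_star_add calg_star_sc)
qed

lemma state_eval_lin:
  assumes "cstar_algebra A" "is_state A \<phi>"
  shows "\<phi> (eval_lin A X Y cs) = (\<Sum>(c, w)\<leftarrow>cs. c * \<phi> (evalw A X Y w))"
  by (induction cs) (auto simp: state_zero[OF assms] state_add[OF assms(2)] state_sc[OF assms(2)])

lemma alg_gen_eq_eval_lin_image:
  assumes "cstar_algebra A"
  shows "alg_gen A (X ` {..<n} \<union> Y ` {..<m}) = eval_lin A X Y ` {cs. valid_lin n m cs}"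
proof
  show "alg_gen A (X ` {..<n} \<union> Y ` {..<m}) \<subseteq> eval_lin A X Y ` {cs. valid_lin n m cs}"
  proof
    fix b assume "b \<in> alg_gen A (X ` {..<n} \<union> Y ` {..<m})"
    then show "b \<in> eval_lin A X Y ` {cs. valid_lin n m cs}"
    proof (induction rule: alg_gen.induct)
      case one
      show ?case using eval_lin_single[OF assms, of X Y "[]"] by (intro image_eqI[of _ _ "[(1, [])]"]) auto
    next
      case (gen s)
      then obtain l where "valid_lett n m l" "s = lett_val X Y l"
        by (metis Un_iff imageE lessThan_iff lett_val.simps valid_lett.simps)
      then show ?case using eval_lin_single[OF assms, of X Y "[l]"] assms
        by (intro image_eqI[of _ _ "[(1, [l])]"]) (auto simp: valid_word_def calg_mul_one)
    next
      case (add a b)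
      then obtain cs ds where "valid_lin n m cs" "a = eval_lin A X Y cs"
        and "valid_lin n m ds" "b = eval_lin A X Y ds" by blast
      then show ?case using eval_lin_append[OF assms, of X Y cs ds]
        by (intro image_eqI[of _ _ "cs @ ds"]) auto
    next
      case (mul a b)
      then obtain cs ds where "valid_lin n m cs" "a = eval_lin A X Y cs"
        and "valid_lin n m ds" "b = eval_lin A X Y ds" by blast
      then show ?case using eval_lin_mult[OF assms, of X Y cs ds] valid_lin_mult
        by (intro image_eqI[of _ _ "mult_lin cs ds"]) auto
    next
      case (sc a c)
      then obtain cs where "valid_lin n m cs" "a = eval_lin A X Y cs" by blast
      then show ?case using eval_lin_scale[OF assms, of X Y c cs]
        by (intro image_eqI[of _ _ "scale_lin c cs"]) auto
    qed
  qed
next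
  show "eval_lin A X Y ` {cs. valid_lin n m cs} \<subseteq> alg_gen A (X ` {..<n} \<union> Y ` {..<m})"
  proof clarify
    fix cs assume "valid_lin n m cs"
    then show "eval_lin A X Y cs \<in> alg_gen A (X ` {..<n} \<union> Y ` {..<m})"
    proof (induction cs)
      case Nil
      have "csc A 0 (cone A) \<in> alg_gen A (X ` {..<n} \<union> Y ` {..<m})" by (intro alg_gen.sc alg_gen.one)
      then show ?case by (simp add: calg_sc_0[OF assms])
    next
      case (Cons cw cs)
      then show ?case
        by (cases cw) (auto simp: valid_lin_def intro!: alg_gen.add alg_gen.sc evalw_in_alg_gen)
    qed
  qed
qed

section \<open>Hilbert spaces\<close>

lemma hilbert_axioms:
  assumes "hilbert H"
  shows hilbert_add_assoc: "hadd H (hadd H x y) z = hadd H x (hadd H y z)"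
  and hilbert_add_comm: "hadd H x y = hadd H y x"
  and hilbert_add_zero: "hadd H x (hzero H) = x"
  and hilbert_add_neg: "hadd H x (hsc H (-1) x) = hzero H"
  and hilbert_sc_one: "hsc H 1 x = x"
  and hilbert_sc_sc: "hsc H s (hsc H t x) = hsc H (s * t) x"
  and hilbert_sc_add_left: "hsc H (s + t) x = hadd H (hsc H s x) (hsc H t x)"
  and hilbert_sc_add_right: "hsc H s (hadd H x y) = hadd H (hsc H s x) (hsc H s y)"
  and hinner_add_left: "hinner H (hadd H x y) z = hinner H x z + hinner H y z"
  and hinner_sc_left: "hinner H (hsc H s x) y = s * hinner H x y"
  and hinner_commute: "hinner H x y = cnj (hinner H y x)"
  and hinner_self_Im: "Im (hinner H x x) = 0"
  and hinner_self_Re_nonneg: "0 \<le> Re (hinner H x x)"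
  and hinner_self_eq_0: "hinner H x x = 0 \<Longrightarrow> x = hzero H"
  using assms unfolding hilbert_def by ((elim conjE)?, metis)+

lemma hilbert_complete:
  fixes f :: "nat \<Rightarrow> 'h"
  assumes "hilbert H" "\<forall>e>0. \<exists>N. \<forall>k\<ge>N. \<forall>l\<ge>N. hnorm H (hsub H (f k) (f l)) < e"
  shows "\<exists>x. \<forall>e>0. \<exists>N. \<forall>k\<ge>N. hnorm H (hsub H (f k) x) < e"
proof -
  have "\<forall>f :: nat \<Rightarrow> 'h. (\<forall>e>0. \<exists>N. \<forall>k\<ge>N. \<forall>l\<ge>N. hnorm H (hsub H (f k) (f l)) < e) \<longrightarrow>
      (\<exists>x. \<forall>e>0. \<exists>N. \<forall>k\<ge>N. hnorm H (hsub H (f k) x) < e)"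
    using assms(1) unfolding hilbert_def by (elim conjE) assumption
  with assms(2) show ?thesis by blast
qed

lemma hilbert_add_right_eq_self:
  assumes H: "hilbert H" and "hadd H a b = a" shows "b = hzero H"
proof -
  have "b = hadd H b (hadd H a (hsc H (-1) a))" using H by (simp add: hilbert_add_neg hilbert_add_zero)
  also have "\<dots> = hadd H (hadd H a b) (hsc H (-1) a)"
    using hilbert_add_assoc[OF H, of b a] hilbert_add_comm[OF H, of a b] by simp
  also have "\<dots> = hzero H" using assms by (simp add: hilbert_add_neg)
  finally show ?thesis .
qed

lemma hilbert_zero_add: "hilbert H \<Longrightarrow> hadd H (hzero H) a = a"
  by (metis hilbert_add_comm hilbert_add_zero)

lemma hilbert_sc_0: "hilbert H \<Longrightarrow> hsc H 0 a = hzero H"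
  by (rule hilbert_add_right_eq_self[of H "hsc H 0 a"], assumption) (simp add: hilbert_sc_add_left[symmetric])

lemma hilbert_sc_zero: "hilbert H \<Longrightarrow> hsc H c (hzero H) = hzero H"
  by (rule hilbert_add_right_eq_self[of H "hsc H c (hzero H)"], assumption)
    (simp add: hilbert_sc_add_right[symmetric] hilbert_add_zero)

lemma hinner_zero_left: "hilbert H \<Longrightarrow> hinner H (hzero H) y = 0"
  by (metis hilbert_sc_zero hinner_sc_left mult_zero_left)

lemma hinner_zero_right: "hilbert H \<Longrightarrow> hinner H y (hzero H) = 0"
  by (metis complex_cnj_zero hinner_commute hinner_zero_left)

lemma hinner_add_right: "hilbert H \<Longrightarrow> hinner H z (hadd H x y) = hinner H z x + hinner H z y"
  by (metis complex_cnj_add hinner_add_left hinner_commute)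

lemma hinner_sc_right: "hilbert H \<Longrightarrow> hinner H y (hsc H s x) = cnj s * hinner H y x"
  by (metis complex_cnj_mult hinner_commute hinner_sc_left)

lemma hinner_diff_left: "hilbert H \<Longrightarrow> hinner H (hsub H x y) z = hinner H x z - hinner H y z"
  by (simp add: hsub_def hinner_add_left hinner_sc_left)

lemma hinner_diff_right: "hilbert H \<Longrightarrow> hinner H z (hsub H x y) = hinner H z x - hinner H z y"
  by (simp add: hsub_def hinner_add_right hinner_sc_right)

lemma hnorm_nonneg: "hilbert H \<Longrightarrow> 0 \<le> hnorm H x"
  by (simp add: hnorm_def hinner_self_Re_nonneg)

lemma hnorm_power2: "hilbert H \<Longrightarrow> (hnorm H x)\<^sup>2 = Re (hinner H x x)"
  by (simp add: hnorm_def hinner_self_Re_nonneg)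

lemma hinner_self: "hilbert H \<Longrightarrow> hinner H x x = complex_of_real ((hnorm H x)\<^sup>2)"
  by (simp add: hnorm_power2 complex_eq_iff hinner_self_Im)

lemma hnorm_eq_0_iff: "hilbert H \<Longrightarrow> hnorm H x = 0 \<longleftrightarrow> x = hzero H"
  by (metis hinner_self hinner_self_eq_0 hinner_zero_left of_real_0 power_zero_numeral zero_less_numeral
      power_eq_0_iff hnorm_def real_sqrt_zero zero_complex.simps(1))

lemma hnorm_zero [simp]: "hilbert H \<Longrightarrow> hnorm H (hzero H) = 0"
  by (simp add: hnorm_eq_0_iff)

lemma hnorm_sc: assumes "hilbert H" shows "hnorm H (hsc H s x) = cmod s * hnorm H x"
proof -
  have "hinner H (hsc H s x) (hsc H s x) = (s * cnj s) * hinner H x x"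
    using assms by (simp add: hinner_sc_left hinner_sc_right)
  also have "s * cnj s = complex_of_real ((cmod s)\<^sup>2)" by (rule complex_norm_square[symmetric])
  finally have "Re (hinner H (hsc H s x) (hsc H s x)) = (cmod s)\<^sup>2 * Re (hinner H x x)"
    by simp
  then show ?thesis by (simp add: hnorm_def real_sqrt_mult)
qed

lemma hsub_self: "hilbert H \<Longrightarrow> hsub H x x = hzero H"
  by (simp add: hsub_def hilbert_add_neg)

lemma hsub_add_cancel: "hilbert H \<Longrightarrow> hadd H (hsub H x y) y = x"
  by (metis hilbert_add_assoc hilbert_add_comm hilbert_add_neg hilbert_add_zero hsub_def)

lemma hsub_eq_zero_iff: "hilbert H \<Longrightarrow> hsub H x y = hzero H \<longleftrightarrow> x = y"
  by (metis hilbert_zero_add hsub_add_cancel hsub_self)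

lemma hnorm_hsub_commute: assumes H: "hilbert H" shows "hnorm H (hsub H y x) = hnorm H (hsub H x y)"
proof -
  have "hsub H y x = hsc H (-1) (hsub H x y)"
    unfolding hsub_def hilbert_sc_add_right[OF H] hilbert_sc_sc[OF H]
    by (simp add: hilbert_sc_one[OF H] hilbert_add_comm[OF H, of y])
  then show ?thesis by (simp add: hnorm_sc[OF H])
qed

lemma hinner_cauchy_schwarz:
  assumes H: "hilbert H"
  shows "cmod (hinner H x y) \<le> hnorm H x * hnorm H y"
proof (cases "y = hzero H")
  case True
  then show ?thesis using H by (simp add: hinner_zero_right hnorm_nonneg)
next
  case False
  define a where "a = (hnorm H x)\<^sup>2"
  define b where "b = (hnorm H y)\<^sup>2"
  define c where "c = hinner H x y"
  have "b > 0" using False hnorm_eq_0_iff[OF H, of y] hnorm_nonneg[OF H, of y] unfolding b_def by simp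
  \<comment> \<open>expand \<open>\<langle>x + s y, x + s y\<rangle> \<ge> 0\<close> at the minimising \<open>s = - c / b\<close>\<close>
  define s where "s = - c / complex_of_real b"
  define u where "u = hadd H x (hsc H s y)"
  have "hinner H u u = hinner H x x + cnj s * hinner H x y + s * hinner H y x + s * cnj s * hinner H y y"
    unfolding u_def hinner_add_left[OF H] hinner_add_right[OF H] hinner_sc_left[OF H] hinner_sc_right[OF H]
    by (simp add: algebra_simps)
  also have "\<dots> = of_real a + cnj s * c + s * cnj c + s * cnj s * of_real b"
    unfolding a_def b_def c_def hinner_self[OF H] hinner_commute[OF H, of y x] by simp
  also have "\<dots> = of_real (a - (cmod c)\<^sup>2 / b)"
  proof -
    have cc: "c * cnj c = of_real ((cmod c)\<^sup>2)" by (rule complex_norm_square[symmetric])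
    have "cnj s * c = - of_real ((cmod c)\<^sup>2 / b)" "s * cnj c = - of_real ((cmod c)\<^sup>2 / b)"
      "s * cnj s * of_real b = of_real ((cmod c)\<^sup>2 / b)"
      using cc \<open>b > 0\<close> by (simp_all add: s_def mult.commute power2_eq_square)
    then show ?thesis by simp
  qed
  finally have "0 \<le> a - (cmod c)\<^sup>2 / b" using hinner_self_Re_nonneg[OF H, of u] by simp
  then have "(cmod c)\<^sup>2 \<le> (hnorm H x * hnorm H y)\<^sup>2"
    using \<open>b > 0\<close> by (simp add: a_def b_def field_simps power_mult_distrib)
  then show ?thesis unfolding c_def
    by (rule power2_le_imp_le) (simp add: hnorm_nonneg[OF H])
qed

lemma hnorm_triangle:
  assumes H: "hilbert H"
  shows "hnorm H (hadd H x y) \<le> hnorm H x + hnorm H y"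
proof -
  have "(hnorm H (hadd H x y))\<^sup>2 = (hnorm H x)\<^sup>2 + 2 * Re (hinner H x y) + (hnorm H y)\<^sup>2"
    using H by (simp add: hnorm_power2 hinner_add_left hinner_add_right hinner_commute[of H y x])
  also have "\<dots> \<le> (hnorm H x + hnorm H y)\<^sup>2"
    using hinner_cauchy_schwarz[OF H, of x y] complex_Re_le_cmod[of "hinner H x y"]
    by (simp add: power2_sum)
  finally show ?thesis by (rule power2_le_imp_le) (simp add: hnorm_nonneg[OF H])
qed

lemma hnorm_hsub_triangle:
  assumes H: "hilbert H" shows "hnorm H (hsub H x z) \<le> hnorm H (hsub H x y) + hnorm H (hsub H y z)"
proof -
  have "hadd H (hsub H x y) (hsub H y z) = hsub H x z"
    by (metis H hilbert_add_assoc hsub_add_cancel hsub_def)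
  then show ?thesis using hnorm_triangle[OF H, of "hsub H x y" "hsub H y z"] by simp
qed

lemma hnorm_hsub_add_le:
  assumes H: "hilbert H"
  shows "hnorm H (hsub H (hadd H x y) (hadd H a b)) \<le> hnorm H (hsub H x a) + hnorm H (hsub H y b)"
proof -
  have "hsub H (hadd H x y) (hadd H a b) = hadd H (hsub H x a) (hsub H y b)"
    unfolding hsub_def
    by (metis H hilbert_add_assoc hilbert_add_comm hilbert_sc_add_right)
  then show ?thesis by (simp add: hnorm_triangle[OF H])
qed

lemma hsub_sc: "hilbert H \<Longrightarrow> hsub H (hsc H s x) (hsc H s a) = hsc H s (hsub H x a)"
  by (simp add: hsub_def hilbert_sc_add_right hilbert_sc_sc mult.commute)

lemma hnorm_diff_le_hnorm_hsub:
  assumes H: "hilbert H" shows "\<bar>hnorm H x - hnorm H y\<bar> \<le> hnorm H (hsub H x y)"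
  using hnorm_triangle[OF H, of "hsub H x y" y] hnorm_triangle[OF H, of "hsub H y x" x]
    hsub_add_cancel[OF H] hnorm_hsub_commute[OF H, of x y] by (simp add: abs_le_iff)

lemma hinner_diff_le_left:
  "hilbert H \<Longrightarrow> cmod (hinner H x z - hinner H y z) \<le> hnorm H (hsub H x y) * hnorm H z"
  by (metis hinner_cauchy_schwarz hinner_diff_left)

lemma hinner_diff_le_right:
  "hilbert H \<Longrightarrow> cmod (hinner H z x - hinner H z y) \<le> hnorm H z * hnorm H (hsub H x y)"
  by (metis hinner_cauchy_schwarz hinner_diff_right)

lemma nonpos_if_le_mult_epsilon:
  assumes "\<And>e. e > 0 \<Longrightarrow> (d::real) \<le> C * e" "C \<ge> 0" shows "d \<le> 0"
proof (rule field_le_epsilon)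
  fix e :: real assume "e > 0"
  then have "e / (C + 1) > 0" using assms(2) by simp
  then have "d \<le> C * (e / (C + 1))" by (rule assms(1))
  also have "\<dots> \<le> 0 + e" using \<open>e > 0\<close> assms(2) by (simp add: field_simps)
  finally show "d \<le> 0 + e" .
qed

lemma hinner_eq_0_on_hclosure:
  assumes H: "hilbert H" and orth: "\<forall>s\<in>S. hinner H d s = 0" and x: "x \<in> hclosure H S"
  shows "hinner H d x = 0"
proof -
  have "cmod (hinner H d x) \<le> 0"
  proof (rule nonpos_if_le_mult_epsilon[of _ "hnorm H d"])
    fix e :: real assume "e > 0"
    then obtain s where s: "s \<in> S" "hnorm H (hsub H x s) < e" using x unfolding hclosure_def by blast
    have "cmod (hinner H d x - hinner H d s) \<le> hnorm H d * hnorm H (hsub H x s)"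
      by (rule hinner_diff_le_right[OF H])
    also have "\<dots> \<le> hnorm H d * e" using s(2) by (intro mult_left_mono) (auto simp: hnorm_nonneg[OF H])
    finally show "cmod (hinner H d x) \<le> hnorm H d * e" using orth s(1) by simp
  qed (simp add: hnorm_nonneg[OF H])
  then show ?thesis by simp
qed

text \<open>An inner-product preserving correspondence \<open>a c \<mapsto> b c\<close> between spanning families of
  two Hilbert spaces extends by continuity to a linear isometry on the closure of the first family.\<close>

locale isometric_correspondence =
  fixes H :: "'h hspace" and H0 :: "'k hspace" and S :: "'c set"
    and a :: "'c \<Rightarrow> 'h" and b :: "'c \<Rightarrow> 'k"
  assumes hilbert_H: "hilbert H" and hilbert_H0: "hilbert H0"
    and inner_match: "c \<in> S \<Longrightarrow> d \<in> S \<Longrightarrow> hinner H0 (b c) (b d) = hinner H (a c) (a d)"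
    and add_closed: "c \<in> S \<Longrightarrow> d \<in> S \<Longrightarrow>
      \<exists>f\<in>S. a f = hadd H (a c) (a d) \<and> b f = hadd H0 (b c) (b d)"
    and sc_closed: "c \<in> S \<Longrightarrow> \<exists>f\<in>S. a f = hsc H s (a c) \<and> b f = hsc H0 s (b c)"
begin

definition approximated_by :: "'h \<Rightarrow> 'k \<Rightarrow> bool" where
  "approximated_by x y \<longleftrightarrow>
    (\<forall>e>0. \<exists>c\<in>S. hnorm H (hsub H x (a c)) < e \<and> hnorm H0 (hsub H0 y (b c)) < e)"

definition extension :: "'h \<Rightarrow> 'k" where
  "extension x = (SOME y. approximated_by x y)"

lemma gen_in_hclosure: "c \<in> S \<Longrightarrow> a c \<in> hclosure H (a ` S)"
  using hilbert_H unfolding hclosure_def by (auto simp: hsub_self intro!: bexI[of _ c])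

lemma norm_match: "c \<in> S \<Longrightarrow> hnorm H0 (b c) = hnorm H (a c)"
  by (simp add: hnorm_def inner_match)

lemma hsub_norm_match:
  assumes "c \<in> S" "d \<in> S" shows "hnorm H0 (hsub H0 (b c) (b d)) = hnorm H (hsub H (a c) (a d))"
proof -
  obtain d' where "d' \<in> S" "a d' = hsc H (-1) (a d)" "b d' = hsc H0 (-1) (b d)"
    using sc_closed[OF assms(2)] by blast
  then obtain f where "f \<in> S" "a f = hsub H (a c) (a d)" "b f = hsub H0 (b c) (b d)"
    using add_closed[OF assms(1)] unfolding hsub_def by metis
  then show ?thesis using norm_match by metis
qed

lemma approximated_by_unique:
  assumes "approximated_by x y1" "approximated_by x y2" shows "y1 = y2"
proof -
  have "hnorm H0 (hsub H0 y1 y2) \<le> 0"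
  proof (rule nonpos_if_le_mult_epsilon[of _ 4])
    fix e :: real assume "e > 0"
    then obtain c1 c2 where c: "c1 \<in> S" "hnorm H (hsub H x (a c1)) < e" "hnorm H0 (hsub H0 y1 (b c1)) < e"
      "c2 \<in> S" "hnorm H (hsub H x (a c2)) < e" "hnorm H0 (hsub H0 y2 (b c2)) < e"
      using assms unfolding approximated_by_def by blast
    have "hnorm H0 (hsub H0 (b c1) (b c2)) = hnorm H (hsub H (a c1) (a c2))"
      using hsub_norm_match c by simp
    also have "\<dots> \<le> hnorm H (hsub H (a c1) x) + hnorm H (hsub H x (a c2))"
      by (rule hnorm_hsub_triangle[OF hilbert_H])
    finally have "hnorm H0 (hsub H0 (b c1) (b c2)) < 2 * e"
      using c hnorm_hsub_commute[OF hilbert_H, of "a c1" x] by simp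
    then show "hnorm H0 (hsub H0 y1 y2) \<le> 4 * e"
      using c hnorm_hsub_triangle[OF hilbert_H0, of y1 y2 "b c1"]
        hnorm_hsub_triangle[OF hilbert_H0, of "b c1" y2 "b c2"]
        hnorm_hsub_commute[OF hilbert_H0, of "b c2" y2] by simp
  qed simp
  then show ?thesis
    using hnorm_nonneg[OF hilbert_H0, of "hsub H0 y1 y2"] hnorm_eq_0_iff[OF hilbert_H0] hsub_eq_zero_iff[OF hilbert_H0]
    by simp
qed

text \<open>Approximants of \<open>x\<close> with error \<open>1/(k+1)\<close> have images forming a Cauchy sequence
  in the complete space \<open>H0\<close>; its limit approximates \<open>x\<close> jointly.\<close>

lemma approximated_by_exists:
  assumes "x \<in> hclosure H (a ` S)" shows "\<exists>y. approximated_by x y"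
proof -
  have "\<forall>k. \<exists>c\<in>S. hnorm H (hsub H x (a c)) < 1 / real (Suc k)"
    using assms unfolding hclosure_def by auto
  then obtain f where f: "\<And>k. f k \<in> S" "\<And>k. hnorm H (hsub H x (a (f k))) < 1 / real (Suc k)"
    by metis
  have eventually_small: "\<exists>N. \<forall>k\<ge>N. 1 / real (Suc k) < e" if e: "e > 0" for e :: real
  proof -
    obtain N where N: "inverse (real (Suc N)) < e" using reals_Archimedean[OF e] by blast
    have "1 / real (Suc k) < e" if "k \<ge> N" for k
      using that N frac_le[of 1 1 "real (Suc N)" "real (Suc k)"] by (simp add: inverse_eq_divide)
    then show ?thesis by blast
  qed
  have "\<forall>e>0. \<exists>N. \<forall>k\<ge>N. \<forall>l\<ge>N. hnorm H0 (hsub H0 (b (f k)) (b (f l))) < e"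
  proof (intro allI impI)
    fix e :: real assume "e > 0"
    then obtain N where N: "\<forall>k\<ge>N. 1 / real (Suc k) < e / 2" using eventually_small[of "e / 2"] by auto
    have "hnorm H0 (hsub H0 (b (f k)) (b (f l))) < e" if "k \<ge> N" "l \<ge> N" for k l
    proof -
      have "hnorm H0 (hsub H0 (b (f k)) (b (f l))) = hnorm H (hsub H (a (f k)) (a (f l)))"
        using hsub_norm_match f(1) by simp
      also have "\<dots> \<le> hnorm H (hsub H (a (f k)) x) + hnorm H (hsub H x (a (f l)))"
        by (rule hnorm_hsub_triangle[OF hilbert_H])
      also have "\<dots> < e"
        using f(2)[of k] f(2)[of l] N[rule_format, OF that(1)] N[rule_format, OF that(2)]
          hnorm_hsub_commute[OF hilbert_H, of "a (f k)" x] by simp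
      finally show ?thesis .
    qed
    then show "\<exists>N. \<forall>k\<ge>N. \<forall>l\<ge>N. hnorm H0 (hsub H0 (b (f k)) (b (f l))) < e" by blast
  qed
  then obtain y where y: "\<forall>e>0. \<exists>N. \<forall>k\<ge>N. hnorm H0 (hsub H0 (b (f k)) y) < e"
    using hilbert_complete[OF hilbert_H0, of "\<lambda>k. b (f k)"] by blast
  have "approximated_by x y" unfolding approximated_by_def
  proof (intro allI impI)
    fix e :: real assume "e > 0"
    then obtain N1 N2 where "\<forall>k\<ge>N1. hnorm H0 (hsub H0 (b (f k)) y) < e" "\<forall>k\<ge>N2. 1 / real (Suc k) < e"
      using y eventually_small by blast
    then have "hnorm H (hsub H x (a (f (max N1 N2)))) < e" "hnorm H0 (hsub H0 y (b (f (max N1 N2)))) < e"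
      using f(2)[of "max N1 N2"] hnorm_hsub_commute[OF hilbert_H0, of y "b (f (max N1 N2))"]
      by (simp_all add: less_trans)
    then show "\<exists>c\<in>S. hnorm H (hsub H x (a c)) < e \<and> hnorm H0 (hsub H0 y (b c)) < e"
      using f(1) by blast
  qed
  then show ?thesis by blast
qed

lemma extension_approximates: "x \<in> hclosure H (a ` S) \<Longrightarrow> approximated_by x (extension x)"
  unfolding extension_def by (rule someI_ex[OF approximated_by_exists])

lemma extension_eqI: assumes "approximated_by x y" shows "extension x = y"
proof -
  have "approximated_by x (extension x)" unfolding extension_def using assms by (rule someI)
  then show ?thesis using assms by (rule approximated_by_unique)
qed

lemma extension_gen: assumes "c \<in> S" shows "extension (a c) = b c"
proof (rule extension_eqI)
  show "approximated_by (a c) (b c)"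
    unfolding approximated_by_def using assms
    by (intro allI impI bexI[of _ c])
      (simp_all add: hsub_self hilbert_H hilbert_H0)
qed

lemma approximated_by_add:
  assumes "approximated_by x y" "approximated_by x' y'"
  shows "approximated_by (hadd H x x') (hadd H0 y y')"
  unfolding approximated_by_def
proof (intro allI impI)
  fix e :: real assume "e > 0"
  then have "e / 2 > 0" by simp
  then obtain c c' where c: "c \<in> S" "hnorm H (hsub H x (a c)) < e / 2" "hnorm H0 (hsub H0 y (b c)) < e / 2"
    and c': "c' \<in> S" "hnorm H (hsub H x' (a c')) < e / 2" "hnorm H0 (hsub H0 y' (b c')) < e / 2"
    using assms unfolding approximated_by_def by blast
  then obtain f where f: "f \<in> S" "a f = hadd H (a c) (a c')" "b f = hadd H0 (b c) (b c')"
    using add_closed by blast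
  have "hnorm H (hsub H (hadd H x x') (a f)) < e" "hnorm H0 (hsub H0 (hadd H0 y y') (b f)) < e"
    using c c' f hnorm_hsub_add_le[OF hilbert_H, of x x' "a c" "a c'"]
      hnorm_hsub_add_le[OF hilbert_H0, of y y' "b c" "b c'"] by simp_all
  with f(1) show "\<exists>f\<in>S. hnorm H (hsub H (hadd H x x') (a f)) < e \<and>
      hnorm H0 (hsub H0 (hadd H0 y y') (b f)) < e" by blast
qed

lemma approximated_by_sc:
  assumes "approximated_by x y" shows "approximated_by (hsc H s x) (hsc H0 s y)"
  unfolding approximated_by_def
proof (intro allI impI)
  fix e :: real assume "e > 0"
  define e' where "e' = e / (cmod s + 1)"
  have "e' > 0" using \<open>e > 0\<close> by (simp add: e'_def divide_pos_pos add_nonneg_pos)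
  have "cmod s * e' < (cmod s + 1) * e'" using \<open>e' > 0\<close> by simp
  also have "(cmod s + 1) * e' = e"
    unfolding e'_def using add_nonneg_pos[OF norm_ge_zero[of s] zero_less_one] by simp
  finally have "cmod s * e' < e" .
  obtain c where c: "c \<in> S" "hnorm H (hsub H x (a c)) < e'" "hnorm H0 (hsub H0 y (b c)) < e'"
    using assms \<open>e' > 0\<close> unfolding approximated_by_def by blast
  then obtain f where f: "f \<in> S" "a f = hsc H s (a c)" "b f = hsc H0 s (b c)"
    using sc_closed by blast
  have "cmod s * hnorm H (hsub H x (a c)) < e" "cmod s * hnorm H0 (hsub H0 y (b c)) < e"
    using mult_left_mono[OF less_imp_le[OF c(2)], of "cmod s"] mult_left_mono[OF less_imp_le[OF c(3)], of "cmod s"]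
      \<open>cmod s * e' < e\<close> by simp_all
  then have "hnorm H (hsub H (hsc H s x) (a f)) < e" "hnorm H0 (hsub H0 (hsc H0 s y) (b f)) < e"
    by (simp_all add: f hsub_sc hnorm_sc hilbert_H hilbert_H0)
  with f(1) show "\<exists>f\<in>S. hnorm H (hsub H (hsc H s x) (a f)) < e \<and>
      hnorm H0 (hsub H0 (hsc H0 s y) (b f)) < e" by blast
qed

lemma hnorm_extension:
  assumes "x \<in> hclosure H (a ` S)" shows "hnorm H0 (extension x) = hnorm H x"
proof -
  have "\<bar>hnorm H0 (extension x) - hnorm H x\<bar> \<le> 0"
  proof (rule nonpos_if_le_mult_epsilon[of _ 2])
    fix e :: real assume "e > 0"
    then obtain c where c: "c \<in> S" "hnorm H (hsub H x (a c)) < e" "hnorm H0 (hsub H0 (extension x) (b c)) < e"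
      using extension_approximates[OF assms] unfolding approximated_by_def by blast
    then show "\<bar>hnorm H0 (extension x) - hnorm H x\<bar> \<le> 2 * e"
      using hnorm_diff_le_hnorm_hsub[OF hilbert_H, of x "a c"]
        hnorm_diff_le_hnorm_hsub[OF hilbert_H0, of "extension x" "b c"] norm_match[OF c(1)] by linarith
  qed simp
  then show ?thesis by simp
qed

lemma isometry_on_extension: "isometry_on H (hclosure H (a ` S)) H0 extension"
  unfolding isometry_on_def
proof (intro conjI ballI allI)
  fix x y assume "x \<in> hclosure H (a ` S)" "y \<in> hclosure H (a ` S)"
  then show "extension (hadd H x y) = hadd H0 (extension x) (extension y)"
    by (intro extension_eqI approximated_by_add[OF extension_approximates extension_approximates])
next
  fix s x assume "x \<in> hclosure H (a ` S)"
  then show "extension (hsc H s x) = hsc H0 s (extension x)"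
    by (intro extension_eqI approximated_by_sc[OF extension_approximates])
qed (rule hnorm_extension)

lemma hinner_extension:
  assumes x: "x \<in> hclosure H (a ` S)" and d: "d \<in> S"
  shows "hinner H0 (extension x) (b d) = hinner H x (a d)"
proof -
  have "cmod (hinner H x (a d) - hinner H0 (extension x) (b d)) \<le> 0"
  proof (rule nonpos_if_le_mult_epsilon[of _ "2 * hnorm H (a d)"])
    fix e :: real assume "e > 0"
    then obtain c where c: "c \<in> S" "hnorm H (hsub H x (a c)) < e"
      "hnorm H0 (hsub H0 (extension x) (b c)) < e"
      using extension_approximates[OF x] unfolding approximated_by_def by blast
    have "cmod (hinner H x (a d) - hinner H (a c) (a d)) \<le> e * hnorm H (a d)"
      using hinner_diff_le_left[OF hilbert_H, of x "a d" "a c"]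
        mult_right_mono[OF less_imp_le[OF c(2)] hnorm_nonneg[OF hilbert_H, of "a d"]] by linarith
    moreover have "cmod (hinner H0 (extension x) (b d) - hinner H0 (b c) (b d)) \<le> e * hnorm H (a d)"
      using hinner_diff_le_left[OF hilbert_H0, of "extension x" "b d" "b c"]
        mult_right_mono[OF less_imp_le[OF c(3)] hnorm_nonneg[OF hilbert_H0, of "b d"]]
      by (simp only: norm_match[OF d, symmetric])
    moreover have "hinner H x (a d) - hinner H0 (extension x) (b d) =
        (hinner H x (a d) - hinner H (a c) (a d)) - (hinner H0 (extension x) (b d) - hinner H0 (b c) (b d))"
      using inner_match[OF c(1) d] by simp
    ultimately have "cmod (hinner H x (a d) - hinner H0 (extension x) (b d)) \<le> e * hnorm H (a d) + e * hnorm H (a d)"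
      using norm_triangle_ineq4[of "hinner H x (a d) - hinner H (a c) (a d)"
          "hinner H0 (extension x) (b d) - hinner H0 (b c) (b d)"] by simp
    then show "cmod (hinner H x (a d) - hinner H0 (extension x) (b d)) \<le> 2 * hnorm H (a d) * e"
      by (simp add: algebra_simps)
  qed (simp add: hnorm_nonneg[OF hilbert_H])
  then show ?thesis by simp
qed

end

lemma gns_axioms:
  assumes "gns A \<phi> H \<iota> \<pi>"
  shows gns_hilbert: "hilbert H"
  and gns_add: "\<iota> (cadd A a b) = hadd H (\<iota> a) (\<iota> b)"
  and gns_sc: "\<iota> (csc A s a) = hsc H s (\<iota> a)"
  and gns_inner: "hinner H (\<iota> a) (\<iota> b) = \<phi> (cmul A (cstar A b) a)"
  and gns_dense: "hclosure H (range \<iota>) = UNIV"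
  and gns_left_action: "\<pi> a (\<iota> b) = \<iota> (cmul A a b)"
  and gns_left_action_add: "\<pi> a (hadd H x y) = hadd H (\<pi> a x) (\<pi> a y)"
  and gns_left_action_sc: "\<pi> a (hsc H s x) = hsc H s (\<pi> a x)"
  and gns_left_action_bounded: "\<exists>C. \<forall>x. hnorm H (\<pi> a x) \<le> C * hnorm H x"
  using assms unfolding gns_def by blast+

lemma gns_zero: "cstar_algebra A \<Longrightarrow> gns A \<phi> H \<iota> \<pi> \<Longrightarrow> \<iota> (czero A) = hzero H"
  by (metis calg_sc_0 gns_hilbert gns_sc hilbert_sc_0)

text \<open>The left action of \<open>a\<close> has adjoint \<open>a*\<close>: checked on the dense range of \<open>\<iota>\<close> and extended
  by boundedness of \<open>\<pi> a\<close>.\<close>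

lemma gns_adjoint:
  assumes A: "cstar_algebra A" and G: "gns A \<phi> H \<iota> \<pi>"
  shows "hinner H (\<pi> a x) (\<iota> b) = hinner H x (\<iota> (cmul A (cstar A a) b))"
proof -
  have H: "hilbert H" using gns_hilbert[OF G] .
  obtain C0 where C0: "\<forall>x. hnorm H (\<pi> a x) \<le> C0 * hnorm H x" using gns_left_action_bounded[OF G] by blast
  define z where "z = \<iota> (cmul A (cstar A a) b)"
  define C where "C = max C0 0 * hnorm H (\<iota> b) + hnorm H z"
  have "cmod (hinner H (\<pi> a x) (\<iota> b) - hinner H x z) \<le> 0"
  proof (rule nonpos_if_le_mult_epsilon)
    fix e :: real assume "e > 0"
    then obtain c where c: "hnorm H (hsub H x (\<iota> c)) < e"
      using gns_dense[OF G] unfolding hclosure_def by blast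
    have on_range: "hinner H (\<pi> a (\<iota> c)) (\<iota> b) = hinner H (\<iota> c) z"
      unfolding z_def gns_left_action[OF G] gns_inner[OF G] calg_star_mul[OF A] calg_star_star[OF A]
        calg_mul_assoc[OF A] ..
    have "hnorm H (\<pi> a (hsub H x (\<iota> c))) \<le> max C0 0 * e"
    proof -
      have "hnorm H (\<pi> a (hsub H x (\<iota> c))) \<le> max C0 0 * hnorm H (hsub H x (\<iota> c))"
        using C0 hnorm_nonneg[OF H] by (meson max.cobounded1 mult_right_mono order_trans)
      also have "\<dots> \<le> max C0 0 * e" using c by (simp add: mult_left_mono)
      finally show ?thesis .
    qed
    moreover have "hsub H (\<pi> a x) (\<pi> a (\<iota> c)) = \<pi> a (hsub H x (\<iota> c))"
      unfolding hsub_def gns_left_action_add[OF G] gns_left_action_sc[OF G] ..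
    ultimately have "cmod (hinner H (\<pi> a x) (\<iota> b) - hinner H (\<pi> a (\<iota> c)) (\<iota> b)) \<le> max C0 0 * e * hnorm H (\<iota> b)"
      using hinner_diff_le_left[OF H, of "\<pi> a x" "\<iota> b" "\<pi> a (\<iota> c)"] hnorm_nonneg[OF H, of "\<iota> b"]
      by (metis mult_right_mono order_trans)
    moreover have "cmod (hinner H (\<iota> c) z - hinner H x z) \<le> e * hnorm H z"
    proof -
      have "cmod (hinner H (\<iota> c) z - hinner H x z) \<le> hnorm H (hsub H x (\<iota> c)) * hnorm H z"
        using hinner_diff_le_left[OF H, of "\<iota> c" z x] hnorm_hsub_commute[OF H, of "\<iota> c" x] by simp
      also have "\<dots> \<le> e * hnorm H z" using c hnorm_nonneg[OF H, of z] by (simp add: mult_right_mono)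
      finally show ?thesis .
    qed
    ultimately show "cmod (hinner H (\<pi> a x) (\<iota> b) - hinner H x z) \<le> C * e"
      using norm_triangle_ineq[of "hinner H (\<pi> a x) (\<iota> b) - hinner H (\<pi> a (\<iota> c)) (\<iota> b)"
          "hinner H (\<iota> c) z - hinner H x z"]
      unfolding on_range C_def by (simp add: algebra_simps)
  qed (simp add: C_def hnorm_nonneg[OF H])
  then show ?thesis unfolding z_def by simp
qed

lemma gns_hinner_eval_lin:
  assumes A: "cstar_algebra A" and S: "is_state A \<phi>" and G: "gns A \<phi> H \<iota> \<pi>"
    and "\<forall>i<n. cstar A (X i) = X i" "\<forall>j<m. cstar A (Y j) = Y j" and "valid_lin n m ds"
  shows "hinner H (\<iota> (eval_lin A X Y cs)) (\<iota> (eval_lin A X Y ds)) =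
    (\<Sum>(d, v)\<leftarrow>ds. \<Sum>(c, w)\<leftarrow>cs. (cnj d * c) * \<phi> (evalw A X Y (rev v @ w)))"
proof -
  have "hinner H (\<iota> (eval_lin A X Y cs)) (\<iota> (eval_lin A X Y ds)) =
      \<phi> (eval_lin A X Y (mult_lin (map (\<lambda>(c, w). (cnj c, rev w)) ds) cs))"
    using assms by (simp add: gns_inner[OF G] star_eval_lin eval_lin_mult)
  also have "\<dots> = (\<Sum>(d, v)\<leftarrow>ds. \<Sum>(c, w)\<leftarrow>cs. (cnj d * c) * \<phi> (evalw A X Y (rev v @ w)))"
    by (simp add: state_eval_lin[OF A S] mult_lin_def sum_list_concat map_concat o_def split_def)
  finally show ?thesis .
qed

lemma gns_hinner_eval_lin_right:
  assumes A: "cstar_algebra A" and G: "gns A \<phi> H \<iota> \<pi>"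
  shows "hinner H x (\<iota> (eval_lin A X Y cs)) = (\<Sum>(c, w)\<leftarrow>cs. cnj c * hinner H x (\<iota> (evalw A X Y w)))"
proof (induction cs)
  case Nil
  then show ?case by (simp add: gns_zero[OF A G] hinner_zero_right[OF gns_hilbert[OF G]])
next
  case (Cons cw cs)
  then show ?case
    by (cases cw) (simp add: gns_add[OF G] gns_sc[OF G] hinner_add_right[OF gns_hilbert[OF G]]
        hinner_sc_right[OF gns_hilbert[OF G]])
qed

text \<open>Letter order, in \<open>A0\<close>, of the image of a word: the right letters \<open>Y\<close> become left
  multiplications by the \<open>Y'\<close> and are therefore reversed.\<close>

definition twist_word :: "lett list \<Rightarrow> lett list" where
  "twist_word w = filter isLX w @ rev (filter isLY w)"

definition twist_lin :: "(complex \<times> lett list) list \<Rightarrow> (complex \<times> lett list) list" where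
  "twist_lin cs = map (\<lambda>(c, w). (c, twist_word w)) cs"

lemma valid_word_twist: "valid_word n m u \<Longrightarrow> valid_word n m (twist_word u)"
  by (auto simp: valid_word_def twist_word_def)

lemma valid_lin_twist: "valid_lin n m cs \<Longrightarrow> valid_lin n m (twist_lin cs)"
  by (auto simp: valid_lin_def twist_lin_def valid_word_twist)

lemma twist_lin_append [simp]: "twist_lin (cs @ ds) = twist_lin cs @ twist_lin ds"
  by (simp add: twist_lin_def)

lemma twist_lin_scale [simp]: "twist_lin (scale_lin s cs) = scale_lin s (twist_lin cs)"
  by (induction cs) (auto simp: twist_lin_def scale_lin_def)

lemma twist_word_map_LX_LY: "twist_word (map LX is @ map LY js) = map LX is @ map LY (rev js)"
  by (simp add: twist_word_def filter_map o_def rev_map)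

fun lett_index :: "lett \<Rightarrow> nat" where
  "lett_index (LX i) = i" | "lett_index (LY j) = j"

lemma map_LX_lett_index: "\<forall>l\<in>set u. isLX l \<Longrightarrow> map (LX \<circ> lett_index) u = u"
proof (induction u)
  case (Cons l u) then show ?case by (cases l) auto
qed simp

lemma map_LY_lett_index: "\<forall>l\<in>set u. isLY l \<Longrightarrow> map (LY \<circ> lett_index) u = u"
proof (induction u)
  case (Cons l u) then show ?case by (cases l) auto
qed simp

lemma isLY_iff_not_isLX: "isLY l \<longleftrightarrow> \<not> isLX l"
  by (cases l) auto

lemma filter_isLX_and_isLY [simp]:
  "filter (\<lambda>l. isLX l \<and> isLY l) u = []" "filter (\<lambda>l. isLY l \<and> isLX l) u = []"
  by (simp_all add: isLY_iff_not_isLX)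

lemma sum_positions_Cons:
  "(\<Sum>q\<in>{q. q < length (l # w) \<and> (l # w) ! q = c}. g q) =
   (if l = c then g 0 else 0) + (\<Sum>q\<in>{q. q < length w \<and> w ! q = c}. g (Suc q))"
proof -
  have "{q. q < length (l # w) \<and> (l # w) ! q = c} =
      (if l = c then {0} else {}) \<union> Suc ` {q. q < length w \<and> w ! q = c}"
  proof (rule set_eqI)
    fix x show "x \<in> {q. q < length (l # w) \<and> (l # w) ! q = c} \<longleftrightarrow>
        x \<in> (if l = c then {0} else {}) \<union> Suc ` {q. q < length w \<and> w ! q = c}"
      by (cases x) auto
  qed
  moreover have "(\<Sum>q\<in>Suc ` {q. q < length w \<and> w ! q = c}. g q) =
      (\<Sum>q\<in>{q. q < length w \<and> w ! q = c}. g (Suc q))"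
    by (subst sum.reindex) auto
  ultimately show ?thesis by (auto simp: sum.union_disjoint)
qed

lemma sum_positions_append_left:
  assumes "c \<notin> set p"
  shows "(\<Sum>q\<in>{q. q < length (p @ u) \<and> (p @ u) ! q = c}. F (take q (p @ u)) (drop (Suc q) (p @ u))) =
    (\<Sum>k\<in>{k. k < length u \<and> u ! k = c}. F (p @ take k u) (drop (Suc k) u))"
  using assms
proof (induction p arbitrary: F)
  case (Cons l p)
  then have "l \<noteq> c" "c \<notin> set p" by auto
  then have "(\<Sum>q\<in>{q. q < length ((l # p) @ u) \<and> ((l # p) @ u) ! q = c}.
        F (take q ((l # p) @ u)) (drop (Suc q) ((l # p) @ u)))
      = (\<Sum>q\<in>{q. q < length (p @ u) \<and> (p @ u) ! q = c}. F (l # take q (p @ u)) (drop (Suc q) (p @ u)))"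
    unfolding append_Cons by (subst sum_positions_Cons) simp
  then show ?case using Cons.IH[of "\<lambda>x y. F (l # x) y"] \<open>c \<notin> set p\<close> by simp
qed simp

lemma sum_positions_filter:
  assumes "P c"
  shows "(\<Sum>q\<in>{q. q < length w \<and> w ! q = c}. G (filter P (take q w)) (filter P (drop (Suc q) w))) =
    (\<Sum>k\<in>{k. k < length (filter P w) \<and> filter P w ! k = c}. G (take k (filter P w)) (drop (Suc k) (filter P w)))"
proof (induction w arbitrary: G)
  case (Cons l w)
  show ?case
  proof (cases "P l")
    case True
    have "(\<Sum>q\<in>{q. q < length (l # w) \<and> (l # w) ! q = c}.
          G (filter P (take q (l # w))) (filter P (drop (Suc q) (l # w))))
        = (if l = c then G [] (filter P w) else 0) +
          (\<Sum>q\<in>{q. q < length w \<and> w ! q = c}. G (l # filter P (take q w)) (filter P (drop (Suc q) w)))"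
      by (subst sum_positions_Cons) (simp add: True)
    also have "\<dots> = (if l = c then G [] (filter P w) else 0) +
        (\<Sum>k\<in>{k. k < length (filter P w) \<and> filter P w ! k = c}.
          G (l # take k (filter P w)) (drop (Suc k) (filter P w)))"
      using Cons.IH[of "\<lambda>x y. G (l # x) y"] by simp
    also have "\<dots> = (\<Sum>k\<in>{k. k < length (filter P (l # w)) \<and> filter P (l # w) ! k = c}.
        G (take k (filter P (l # w))) (drop (Suc k) (filter P (l # w))))"
      unfolding filter.simps if_P[OF True] by (subst sum_positions_Cons) simp
    finally show ?thesis .
  next
    case False
    then have "l \<noteq> c" using assms by auto
    have "(\<Sum>q\<in>{q. q < length (l # w) \<and> (l # w) ! q = c}.
          G (filter P (take q (l # w))) (filter P (drop (Suc q) (l # w))))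
        = (\<Sum>q\<in>{q. q < length w \<and> w ! q = c}. G (filter P (take q w)) (filter P (drop (Suc q) w)))"
      by (subst sum_positions_Cons) (simp add: False \<open>l \<noteq> c\<close>)
    then show ?thesis using Cons.IH[of G] False by simp
  qed
qed simp

lemma gns_hinner_left_action_evalw:
  assumes "cstar_algebra A" "gns A \<phi> H \<iota> \<pi>"
    and "\<forall>i<n. cstar A (X i) = X i" "\<forall>j<m. cstar A (Y j) = Y j" "valid_word n m w"
  shows "hinner H (\<pi> (evalw A X Y w) \<xi>) (\<iota> (cone A)) = hinner H \<xi> (\<iota> (evalw A X Y (rev w)))"
  using assms by (simp add: gns_adjoint star_evalw calg_mul_one)

section \<open>The bi-partite system and its tracial model\<close>

locale bipartite_moment_model =
  fixes A :: "'a cstar_alg" and \<phi> :: "'a \<Rightarrow> complex"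
    and A0 :: "'b cstar_alg" and \<tau>0 :: "'b \<Rightarrow> complex"
    and n m :: nat
    and X Y :: "nat \<Rightarrow> 'a" and X' Y' :: "nat \<Rightarrow> 'b"
    and H :: "'h hspace" and \<iota> :: "'a \<Rightarrow> 'h" and \<pi> :: "'a \<Rightarrow> 'h \<Rightarrow> 'h"
    and H0 :: "'k hspace" and \<iota>0 :: "'b \<Rightarrow> 'k" and \<pi>0 :: "'b \<Rightarrow> 'k \<Rightarrow> 'k"
  assumes ncps: "cstar_ncps A \<phi>" and ncps0: "cstar_ncps A0 \<tau>0"
    and sa_X: "\<forall>i<n. cstar A (X i) = X i" and sa_Y: "\<forall>j<m. cstar A (Y j) = Y j"
    and sa_X': "\<forall>i<n. cstar A0 (X' i) = X' i" and sa_Y': "\<forall>j<m. cstar A0 (Y' j) = Y' j"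
    and X_Y_commute: "i < n \<Longrightarrow> j < m \<Longrightarrow> cmul A (X i) (Y j) = cmul A (Y j) (X i)"
    and trace0: "tracial_on A0 \<tau>0 UNIV"
    and moments: "\<forall>is js. (\<forall>i\<in>set is. i < n) \<longrightarrow> (\<forall>j\<in>set js. j < m) \<longrightarrow>
        \<phi> (evalw A X Y (map LX is @ map LY js)) =
        \<tau>0 (evalw A0 X' Y' (map LX is @ map LY (rev js)))"
    and gnsA: "gns A \<phi> H \<iota> \<pi>" and gnsA0: "gns A0 \<tau>0 H0 \<iota>0 \<pi>0"
begin

lemma algebra_A: "cstar_algebra A" and algebra_A0: "cstar_algebra A0"
  and state_\<phi>: "is_state A \<phi>" and state_\<tau>0: "is_state A0 \<tau>0"
  using ncps ncps0 by (simp_all add: cstar_ncps_def)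

lemma Y_commute_X_word:
  assumes "j < m" "valid_word n m u" "\<forall>l\<in>set u. isLX l"
  shows "cmul A (Y j) (evalw A X Y u) = cmul A (evalw A X Y u) (Y j)"
  using assms(2,3)
proof (induction u)
  case Nil
  show ?case by (simp add: algebra_A calg_one_mul calg_mul_one)
next
  case (Cons l u)
  then obtain i where "l = LX i" "i < n" "valid_word n m u" "\<forall>l\<in>set u. isLX l"
    by (cases l) (auto simp: valid_word_def)
  with Cons.IH X_Y_commute[OF _ assms(1)] show ?case
    by (metis algebra_A calg_mul_assoc evalw.simps(2) lett_val.simps(1))
qed

lemma evalw_sort_letters:
  "valid_word n m w \<Longrightarrow> evalw A X Y w = evalw A X Y (filter isLX w @ filter isLY w)"
proof (induction w)
  case (Cons l w)
  then have w: "valid_word n m w" by (simp add: valid_word_def)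
  show ?case
  proof (cases l)
    case (LX i)
    then show ?thesis using Cons.IH[OF w] by simp
  next
    case (LY j)
    then have "j < m" using Cons.prems by (simp add: valid_word_def)
    have "evalw A X Y (l # w) = cmul A (Y j) (cmul A (evalw A X Y (filter isLX w)) (evalw A X Y (filter isLY w)))"
      using Cons.IH[OF w] by (simp add: LY evalw_append algebra_A)
    also have "\<dots> = cmul A (evalw A X Y (filter isLX w)) (cmul A (Y j) (evalw A X Y (filter isLY w)))"
      using Y_commute_X_word[OF \<open>j < m\<close> valid_word_filter[OF w], of isLX]
      by (simp add: calg_mul_assoc[OF algebra_A, symmetric])
    also have "\<dots> = evalw A X Y (filter isLX (l # w) @ filter isLY (l # w))"
      by (simp add: LY evalw_append algebra_A)
    finally show ?thesis .
  qed
qed simp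

lemma state_evalw_twist:
  assumes "valid_word n m w" shows "\<phi> (evalw A X Y w) = \<tau>0 (evalw A0 X' Y' (twist_word w))"
proof -
  define "is" where "is = map lett_index (filter isLX w)"
  define js where "js = map lett_index (filter isLY w)"
  have LX_is: "map LX is = filter isLX w" and LY_js: "map LY js = filter isLY w"
    unfolding is_def js_def by (auto intro: map_LX_lett_index map_LY_lett_index)
  have "\<forall>i\<in>set is. i < n" "\<forall>j\<in>set js. j < m"
    using assms unfolding is_def js_def valid_word_def
    by (auto elim!: valid_lett.elims)
  then have "\<phi> (evalw A X Y (map LX is @ map LY js)) = \<tau>0 (evalw A0 X' Y' (map LX is @ map LY (rev js)))"
    using moments by blast
  then show ?thesis
    using evalw_sort_letters[OF assms] by (simp add: LX_is LY_js twist_word_def flip: rev_map)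
qed

lemma trace_evalw_rotate: "\<tau>0 (evalw A0 X' Y' (u @ v)) = \<tau>0 (evalw A0 X' Y' (v @ u))"
  using trace0 by (simp add: tracial_on_def evalw_append algebra_A0)

lemma state_evalw_rev_append:
  assumes "valid_word n m v" "valid_word n m w"
  shows "\<phi> (evalw A X Y (rev v @ w)) = \<tau>0 (evalw A0 X' Y' (rev (twist_word v) @ twist_word w))"
proof -
  have "\<phi> (evalw A X Y (rev v @ w)) = \<tau>0 (evalw A0 X' Y' (twist_word (rev v @ w)))"
    using assms by (simp add: state_evalw_twist)
  also have "twist_word (rev v @ w) = rev (filter isLX v) @ (filter isLX w @ rev (filter isLY w) @ filter isLY v)"
    by (simp add: twist_word_def rev_filter)
  also have "\<tau>0 (evalw A0 X' Y' \<dots>) = \<tau>0 (evalw A0 X' Y' (rev (twist_word v) @ twist_word w))"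
    using trace_evalw_rotate[of "rev (filter isLX v) @ filter isLX w @ rev (filter isLY w)" "filter isLY v"]
    by (simp add: twist_word_def)
  finally show ?thesis .
qed

lemma hinner_twist_eval_lin:
  assumes "valid_lin n m cs" "valid_lin n m ds"
  shows "hinner H0 (\<iota>0 (eval_lin A0 X' Y' (twist_lin cs))) (\<iota>0 (eval_lin A0 X' Y' (twist_lin ds))) =
    hinner H (\<iota> (eval_lin A X Y cs)) (\<iota> (eval_lin A X Y ds))"
  unfolding gns_hinner_eval_lin[OF algebra_A0 state_\<tau>0 gnsA0 sa_X' sa_Y' valid_lin_twist[OF assms(2)]]
    gns_hinner_eval_lin[OF algebra_A state_\<phi> gnsA sa_X sa_Y assms(2)]
  using assms
  by (simp add: twist_lin_def o_def split_def valid_lin_def state_evalw_rev_append cong: map_cong)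

sublocale isometric_correspondence H H0 "{cs. valid_lin n m cs}" "\<lambda>cs. \<iota> (eval_lin A X Y cs)"
  "\<lambda>cs. \<iota>0 (eval_lin A0 X' Y' (twist_lin cs))"
proof
  fix cs ds assume "cs \<in> {cs. valid_lin n m cs}" "ds \<in> {cs. valid_lin n m cs}"
  then show "hinner H0 (\<iota>0 (eval_lin A0 X' Y' (twist_lin cs))) (\<iota>0 (eval_lin A0 X' Y' (twist_lin ds))) =
      hinner H (\<iota> (eval_lin A X Y cs)) (\<iota> (eval_lin A X Y ds))"
    by (simp add: hinner_twist_eval_lin)
  show "\<exists>f\<in>{cs. valid_lin n m cs}.
      \<iota> (eval_lin A X Y f) = hadd H (\<iota> (eval_lin A X Y cs)) (\<iota> (eval_lin A X Y ds)) \<and>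
      \<iota>0 (eval_lin A0 X' Y' (twist_lin f)) =
      hadd H0 (\<iota>0 (eval_lin A0 X' Y' (twist_lin cs))) (\<iota>0 (eval_lin A0 X' Y' (twist_lin ds)))"
    using \<open>cs \<in> _\<close> \<open>ds \<in> _\<close>
    by (intro bexI[of _ "cs @ ds"])
      (simp_all add: eval_lin_append algebra_A algebra_A0 gns_add[OF gnsA] gns_add[OF gnsA0])
next
  fix cs s assume "cs \<in> {cs. valid_lin n m cs}"
  then show "\<exists>f\<in>{cs. valid_lin n m cs}. \<iota> (eval_lin A X Y f) = hsc H s (\<iota> (eval_lin A X Y cs)) \<and>
      \<iota>0 (eval_lin A0 X' Y' (twist_lin f)) = hsc H0 s (\<iota>0 (eval_lin A0 X' Y' (twist_lin cs)))"
    by (intro bexI[of _ "scale_lin s cs"])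
      (simp_all add: eval_lin_scale algebra_A algebra_A0 gns_sc[OF gnsA] gns_sc[OF gnsA0])
qed (use gns_hilbert[OF gnsA] gns_hilbert[OF gnsA0] in auto)

lemma L2_eq_hclosure:
  "L2 H \<iota> (alg_gen A (X ` {..<n} \<union> Y ` {..<m})) =
    hclosure H ((\<lambda>cs. \<iota> (eval_lin A X Y cs)) ` {cs. valid_lin n m cs})"
  by (simp add: L2_def alg_gen_eq_eval_lin_image[OF algebra_A] image_image)

lemma evalw_in_L2:
  "valid_word n m w \<Longrightarrow> \<iota> (evalw A X Y w) \<in> L2 H \<iota> (alg_gen A (X ` {..<n} \<union> Y ` {..<m}))"
  using gen_in_hclosure[of "[(1, w)]"]
  by (simp add: L2_eq_hclosure calg_sc_one[OF algebra_A] calg_add_zero[OF algebra_A])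

lemma extension_evalw:
  "valid_word n m w \<Longrightarrow> extension (\<iota> (evalw A X Y w)) = \<iota>0 (evalw A0 X' Y' (twist_word w))"
  using extension_gen[of "[(1, w)]"]
  by (simp add: twist_lin_def calg_sc_one algebra_A algebra_A0 calg_add_zero)

text \<open>All positions of \<open>X\<^sub>i\<close> in \<open>rev (twist_word (rev w))\<close> lie after its \<open>Y\<close>-letters;
  traciality moves these letters from the front of the left factor to its end.\<close>

lemma fdq_val_twist:
  assumes w: "valid_word n m w"
  shows "fdq_val A0 \<tau>0 X' Y' i (rev (twist_word (rev w))) = bfdq_val A \<phi> X Y i w"
proof -
  define G where "G a b = \<tau>0 (evalw A0 X' Y' (rev (filter isLY w) @ a)) * \<tau>0 (evalw A0 X' Y' b)" for a b
  have "rev (twist_word (rev w)) = rev (filter isLY w) @ filter isLX w"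
    by (simp add: twist_word_def rev_filter)
  then have "fdq_val A0 \<tau>0 X' Y' i (rev (twist_word (rev w))) =
      (\<Sum>k\<in>{k. k < length (filter isLX w) \<and> filter isLX w ! k = LX i}.
        G (take k (filter isLX w)) (drop (Suc k) (filter isLX w)))"
    unfolding fdq_val_def G_def
    by (simp only:) (rule sum_positions_append_left, simp)
  also have "\<dots> = (\<Sum>q\<in>{q. q < length w \<and> w ! q = LX i}.
      G (filter isLX (take q w)) (filter isLX (drop (Suc q) w)))"
    by (rule sum_positions_filter[symmetric]) simp
  also have "\<dots> = bfdq_val A \<phi> X Y i w"
    unfolding bfdq_val_def
  proof (rule sum.cong[OF refl])
    fix q assume "q \<in> {q. q < length w \<and> w ! q = LX i}"
    then have "w = take q w @ LX i # drop (Suc q) w" by (metis (mono_tags) id_take_nth_drop mem_Collect_eq)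
    then have Y_split: "filter isLY (take q w) @ filter isLY (drop (Suc q) w) = filter isLY w"
      by (metis filter.simps(2) filter_append isLY.simps(1))
    have valid: "valid_word n m (take q w)" "valid_word n m (drop (Suc q) w)"
      using w by (simp_all add: valid_word_take valid_word_drop)
    have "\<phi> (evalw A X Y (take q w @ filter isLY (drop (Suc q) w))) =
        \<tau>0 (evalw A0 X' Y' (filter isLX (take q w) @ rev (filter isLY w)))"
      using valid valid_word_filter Y_split[symmetric]
      by (simp add: state_evalw_twist twist_word_def)
    also have "\<dots> = \<tau>0 (evalw A0 X' Y' (rev (filter isLY w) @ filter isLX (take q w)))"
      by (rule trace_evalw_rotate)
    finally show "G (filter isLX (take q w)) (filter isLX (drop (Suc q) w)) =
        \<phi> (evalw A X Y (take q w @ filter isLY (drop (Suc q) w))) * \<phi> (evalw A X Y (filter isLX (drop (Suc q) w)))"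
      using state_evalw_twist[OF valid_word_filter[OF valid(2)], of isLX]
      by (simp add: G_def twist_word_def)
  qed
  finally show ?thesis .
qed

lemma left_bf_conj_unique:
  assumes "is_left_bf_conj A \<phi> H \<iota> \<pi> n m X Y i \<xi>1" "is_left_bf_conj A \<phi> H \<iota> \<pi> n m X Y i \<xi>2"
  shows "\<xi>1 = \<xi>2"
proof -
  let ?S = "(\<lambda>cs. \<iota> (eval_lin A X Y cs)) ` {cs. valid_lin n m cs}"
  define d where "d = hsub H \<xi>1 \<xi>2"
  have in_closure: "\<xi>1 \<in> hclosure H ?S" "\<xi>2 \<in> hclosure H ?S"
    using assms unfolding is_left_bf_conj_def L2_eq_hclosure by auto
  have conj_inner: "hinner H \<xi> (\<iota> (evalw A X Y v)) = bfdq_val A \<phi> X Y i (rev v)"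
    if "is_left_bf_conj A \<phi> H \<iota> \<pi> n m X Y i \<xi>" "valid_word n m v" for \<xi> v
    using that gns_hinner_left_action_evalw[OF algebra_A gnsA sa_X sa_Y, of "rev v" \<xi>]
    by (simp add: is_left_bf_conj_def)
  have "hinner H d (\<iota> (evalw A X Y v)) = 0" if "valid_word n m v" for v
    using conj_inner[OF assms(1) that] conj_inner[OF assms(2) that]
    by (simp add: d_def hinner_diff_left[OF hilbert_H])
  then have "hinner H d (\<iota> (eval_lin A X Y cs)) = 0" if "valid_lin n m cs" for cs
    using that by (induction cs) (auto simp: gns_hinner_eval_lin_right[OF algebra_A gnsA] valid_lin_def
        gns_zero[OF algebra_A gnsA] hinner_zero_right[OF hilbert_H])
  then have orth: "\<forall>s\<in>?S. hinner H d s = 0" by blast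
  have "hinner H d d = 0"
    using hinner_eq_0_on_hclosure[OF hilbert_H orth in_closure(1)]
      hinner_eq_0_on_hclosure[OF hilbert_H orth in_closure(2)]
    by (simp add: d_def hinner_diff_right[OF hilbert_H])
  then have "d = hzero H" by (rule hinner_self_eq_0[OF hilbert_H])
  then show ?thesis using hsub_eq_zero_iff[OF hilbert_H] by (simp add: d_def)
qed

text \<open>Replacing \<open>\<xi>'\<close> by \<open>P \<xi>'\<close> does not change inner products with the image of the
  extension, which contains the twisted words.\<close>

lemma left_bf_conj_extension:
  assumes P: "orth_proj H0 (extension ` L2 H \<iota> (alg_gen A (X ` {..<n} \<union> Y ` {..<m}))) P"
    and free: "is_free_conj A0 \<tau>0 H0 \<iota>0 \<pi>0 n m X' Y' i \<xi>'"
  obtains \<xi> where "is_left_bf_conj A \<phi> H \<iota> \<pi> n m X Y i \<xi>" "extension \<xi> = P \<xi>'"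
proof -
  let ?L2 = "L2 H \<iota> (alg_gen A (X ` {..<n} \<union> Y ` {..<m}))"
  have "P \<xi>' \<in> extension ` ?L2" using P unfolding orth_proj_def by blast
  then obtain \<xi> where \<xi>: "P \<xi>' = extension \<xi>" "\<xi> \<in> ?L2" by (rule imageE)
  have "is_left_bf_conj A \<phi> H \<iota> \<pi> n m X Y i \<xi>"
    unfolding is_left_bf_conj_def
  proof (intro conjI allI impI)
    fix w assume w: "valid_word n m w"
    let ?z = "\<iota>0 (evalw A0 X' Y' (twist_word (rev w)))"
    have z: "?z \<in> extension ` ?L2"
    proof (rule image_eqI)
      show "?z = extension (\<iota> (evalw A X Y (rev w)))" using w by (simp add: extension_evalw)
      show "\<iota> (evalw A X Y (rev w)) \<in> ?L2" using w by (simp add: evalw_in_L2)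
    qed
    have "hinner H (\<pi> (evalw A X Y w) \<xi>) (\<iota> (cone A)) = hinner H \<xi> (\<iota> (evalw A X Y (rev w)))"
      by (rule gns_hinner_left_action_evalw[OF algebra_A gnsA sa_X sa_Y w])
    also have "\<dots> = hinner H0 (P \<xi>') ?z"
      using hinner_extension[OF \<xi>(2)[unfolded L2_eq_hclosure], of "[(1, rev w)]"] w
      by (simp add: \<xi>(1) twist_lin_def calg_sc_one[OF algebra_A] calg_add_zero[OF algebra_A]
          calg_sc_one[OF algebra_A0] calg_add_zero[OF algebra_A0])
    also have "\<dots> = hinner H0 \<xi>' ?z"
    proof -
      have "hinner H0 (hsub H0 \<xi>' (P \<xi>')) ?z = 0" using P z unfolding orth_proj_def by blast
      then show ?thesis by (simp add: hinner_diff_left[OF hilbert_H0])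
    qed
    also have "\<dots> = fdq_val A0 \<tau>0 X' Y' i (rev (twist_word (rev w)))"
    proof -
      have valid: "valid_word n m (rev (twist_word (rev w)))" using w by (simp add: valid_word_twist)
      then have "hinner H0 (\<pi>0 (evalw A0 X' Y' (rev (twist_word (rev w)))) \<xi>') (\<iota>0 (cone A0)) =
          fdq_val A0 \<tau>0 X' Y' i (rev (twist_word (rev w)))"
        using free by (simp add: is_free_conj_def)
      then show ?thesis
        using gns_hinner_left_action_evalw[OF algebra_A0 gnsA0 sa_X' sa_Y' valid] by simp
    qed
    also have "\<dots> = bfdq_val A \<phi> X Y i w" by (rule fdq_val_twist[OF w])
    finally show "hinner H (\<pi> (evalw A X Y w) \<xi>) (\<iota> (cone A)) = bfdq_val A \<phi> X Y i w" .
  qed (rule \<xi>(2))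
  with \<xi>(1) show thesis by (intro that) simp_all
qed

end

theorem lemma2p26:
  fixes A :: "'a cstar_alg" and \<phi> :: "'a \<Rightarrow> complex"
    and A0 :: "'b cstar_alg" and \<tau>0 :: "'b \<Rightarrow> complex"
    and n m :: nat
    and X Y :: "nat \<Rightarrow> 'a" and X' Y' :: "nat \<Rightarrow> 'b"
    and H :: "'h hspace" and \<iota> :: "'a \<Rightarrow> 'h" and \<pi> :: "'a \<Rightarrow> 'h \<Rightarrow> 'h"
    and H0 :: "'k hspace" and \<iota>0 :: "'b \<Rightarrow> 'k" and \<pi>0 :: "'b \<Rightarrow> 'k \<Rightarrow> 'k"
  assumes ncps: "cstar_ncps A \<phi>"
    and sa_X: "\<forall>i<n. cstar A (X i) = X i"
    and sa_Y: "\<forall>j<m. cstar A (Y j) = Y j"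
    and bip: "tracially_bipartite A \<phi> n m X Y"
    and norel: "no_other_relations A n m X Y"
    and ncps0: "cstar_ncps A0 \<tau>0"
    and trace0: "tracial_on A0 \<tau>0 UNIV"
    and sa_X': "\<forall>i<n. cstar A0 (X' i) = X' i"
    and sa_Y': "\<forall>j<m. cstar A0 (Y' j) = Y' j"
    and moments: "\<forall>is js. (\<forall>i\<in>set is. i < n) \<longrightarrow> (\<forall>j\<in>set js. j < m) \<longrightarrow>
        \<phi> (evalw A X Y (map LX is @ map LY js)) =
        \<tau>0 (evalw A0 X' Y' (map LX is @ map LY (rev js)))"
    and gnsA: "gns A \<phi> H \<iota> \<pi>"
    and gnsA0: "gns A0 \<tau>0 H0 \<iota>0 \<pi>0"
  shows "\<exists>\<Psi>. isometry_on H (L2 H \<iota> (alg_gen A (X ` {..<n} \<union> Y ` {..<m}))) H0 \<Psi> \<and>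
      (\<forall>is js. (\<forall>i\<in>set is. i < n) \<longrightarrow> (\<forall>j\<in>set js. j < m) \<longrightarrow>
        \<Psi> (\<iota> (evalw A X Y (map LX is @ map LY js))) =
        \<iota>0 (evalw A0 X' Y' (map LX is @ map LY (rev js)))) \<and>
      (\<forall>i<n. \<forall>P. orth_proj H0 (\<Psi> ` L2 H \<iota> (alg_gen A (X ` {..<n} \<union> Y ` {..<m}))) P \<longrightarrow>
        (\<forall>\<xi>'. is_free_conj A0 \<tau>0 H0 \<iota>0 \<pi>0 n m X' Y' i \<xi>' \<longrightarrow>
          (\<exists>!\<xi>. is_left_bf_conj A \<phi> H \<iota> \<pi> n m X Y i \<xi>) \<and>
          (\<forall>\<xi>. is_left_bf_conj A \<phi> H \<iota> \<pi> n m X Y i \<xi> \<longrightarrow> \<Psi> \<xi> = P \<xi>')))"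
proof -
  interpret bipartite_moment_model A \<phi> A0 \<tau>0 n m X Y X' Y' H \<iota> \<pi> H0 \<iota>0 \<pi>0
  proof
    show "cmul A (X i) (Y j) = cmul A (Y j) (X i)" if "i < n" "j < m" for i j
      using bip that unfolding tracially_bipartite_def by (meson alg_gen.gen imageI lessThan_iff)
  qed (fact ncps ncps0 sa_X sa_Y sa_X' sa_Y' trace0 moments gnsA gnsA0)+
  let ?L2 = "L2 H \<iota> (alg_gen A (X ` {..<n} \<union> Y ` {..<m}))"
  have "isometry_on H ?L2 H0 extension"
    unfolding L2_eq_hclosure by (rule isometry_on_extension)
  moreover have "extension (\<iota> (evalw A X Y (map LX is @ map LY js))) =
      \<iota>0 (evalw A0 X' Y' (map LX is @ map LY (rev js)))"
    if "\<forall>i\<in>set is. i < n" "\<forall>j\<in>set js. j < m" for "is" js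
  proof -
    have "valid_word n m (map LX is @ map LY js)" using that by (auto simp: valid_word_def)
    then show ?thesis by (simp add: extension_evalw twist_word_map_LX_LY)
  qed
  moreover have "(\<exists>!\<xi>. is_left_bf_conj A \<phi> H \<iota> \<pi> n m X Y i \<xi>) \<and>
      (\<forall>\<xi>. is_left_bf_conj A \<phi> H \<iota> \<pi> n m X Y i \<xi> \<longrightarrow> extension \<xi> = P \<xi>')"
    if "orth_proj H0 (extension ` ?L2) P" "is_free_conj A0 \<tau>0 H0 \<iota>0 \<pi>0 n m X' Y' i \<xi>'" for i P \<xi>'
    using left_bf_conj_extension[OF that] left_bf_conj_unique by metis
  ultimately show ?thesis by blast
qed

end
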